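(* Let $\mathcal K$ be one of the categories $\mathcal{TL}$ or $\mathscr P\mathcal P$, let $m,n\in\mathbb N$, and let $\sigma\in\mathcal K_{nm}$. Then $$\mathbb E(\mathcal K_{mn}^\sigma)=P^\sigma=\operatorname{Reg}(\mathcal K_{mn}^\sigma).$$
   Context: $\mathbb N=\{0,1,2,\ldots\}$, $[n]=\{1,\ldots,n\}$ (with $[0]=\emptyset$), and $A'=\{a':a\in A\}$, $A''=\{a'':a\in A\}$ for $A\subseteq\mathbb N$. $\mathcal P_{mn}$ is the set of all set partitions of $[m]\cup[n]'$. For $\alpha\in\mathcal P_{mn}$ and $\beta\in\mathcal P_{nk}$, the product $\alpha\beta\in\mathcal P_{mk}$ is formed as follows: identify partitions with graphs whose connected components are the blocks; let $\alpha_\downarrow$ be the graph on $[m]\cup[n]''$ obtained from $\alpha$ by renaming each $x'$ to $x''$, let $\beta^\uparrow$ be the graph on $[n]''\cup[k]'$ obtained from $\beta$ by renaming each $x\in[n]$ to $x''$, and let $\Pi(\alpha,\beta)$ be their union on $[m]\cup[n]''\cup[k]'$; two elements of $[m]\cup[k]'$ are in the same block of $\alpha\beta$ iff they are in the same component of $\Pi(\alpha,\beta)$. $\mathscr P\mathcal P$ is the category (object set $\mathbb N$) of planar partitions, i.e. those $\alpha\in\mathcal P_{mn}$ ($m,n\in\mathbb N$) represented by some graph drawn in the plane with vertices $x$ at $(x,1)$ and $x'$ at $(x,0)$, edges inside the rectangle $1\le x\le\max(m,n)$, $0\le y\le1$, and no edge crossings in the interior of the rectangle. $\mathcal{TL}$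 (Temperley-Lieb category) consists of the planar partitions all of whose blocks have size $2$. $\mathcal K_{mn}=\mathcal K\cap\mathcal P_{mn}$. For $\sigma\in\mathcal K_{nm}$, $\mathcal K_{mn}^\sigma$ is the set $\mathcal K_{mn}$ with operation $\alpha\star_\sigma\beta=\alpha\sigma\beta$. For a semigroup $T$, $\operatorname{Reg}(T)$ is its set of (von Neumann) regular elements and $\mathbb E(T)$ is the subsemigroup generated by all idempotents of $T$. $P^\sigma$ is the set of all $\alpha\in\mathcal K_{mn}$ such that $\alpha\sigma\,\mathscr R\,\alpha$ and $\sigma\alpha\,\mathscr L\,\alpha$ in the category $\mathcal K$, where $\alpha\,\mathscr R\,\beta$ means $\alpha=\beta\gamma$ and $\beta=\alpha\delta$ for some $\gamma,\delta\in\mathcal K$, and $\alpha\,\mathscr L\,\beta$ means $\alpha=\gamma\beta$ and $\beta=\delta\alpha$ for some $\gamma,\delta\in\mathcal K$. *)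

theory Defs
  imports "HOL-Analysis.Analysis" "HOL-Library.Disjoint_Sets"
begin

section \<open>Partitions and graphs\<close>

text \<open>The vertices \<open>x\<close>, \<open>x'\<close>, \<open>x''\<close> are \<open>Unprimed x\<close>, \<open>Primed x\<close>, \<open>DPrimed x\<close>. The third kind
  occurs only in the product graphs.\<close>

datatype vertex = Unprimed nat | Primed nat | DPrimed nat

type_synonym part = "vertex set set"

definition verts :: "nat \<Rightarrow> nat \<Rightarrow> vertex set" where
  "verts m n = Unprimed ` {1..m} \<union> Primed ` {1..n}"

definition partitions :: "nat \<Rightarrow> nat \<Rightarrow> part set" where
  "partitions m n = {\<alpha>. partition_on (verts m n) \<alpha>}"

text \<open>A graph is given by a vertex set \<open>V\<close> and a set \<open>E\<close> of two-element subsets of \<open>V\<close>.\<close>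

definition graph_on :: "vertex set \<Rightarrow> vertex set set \<Rightarrow> bool" where
  "graph_on V E \<longleftrightarrow> (\<forall>e\<in>E. e \<subseteq> V \<and> card e = 2)"

definition graph_components :: "vertex set \<Rightarrow> vertex set set \<Rightarrow> vertex set set" where
  "graph_components V E = V // {(u, v). u \<in> V \<and> v \<in> V \<and> (u, v) \<in> {(x, y). {x, y} \<in> E}\<^sup>*}"

section \<open>The product of partitions\<close>

text \<open>The complete graph on each block. The product does not depend on which graph with components
  \<open>\<alpha>\<close> is used.\<close>

definition part_edges :: "part \<Rightarrow> vertex set set" where
  "part_edges \<alpha> = {{u, v} | u v. u \<noteq> v \<and> (\<exists>B\<in>\<alpha>. u \<in> B \<and> v \<in> B)}"

fun rename_down :: "vertex \<Rightarrow> vertex" where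
  "rename_down (Primed x) = DPrimed x"
| "rename_down v = v"

fun rename_up :: "vertex \<Rightarrow> vertex" where
  "rename_up (Unprimed x) = DPrimed x"
| "rename_up v = v"

definition product_verts :: "nat \<Rightarrow> nat \<Rightarrow> nat \<Rightarrow> vertex set" where
  "product_verts m n k = Unprimed ` {1..m} \<union> DPrimed ` {1..n} \<union> Primed ` {1..k}"

definition product_edges :: "part \<Rightarrow> part \<Rightarrow> vertex set set" where
  "product_edges \<alpha> \<beta> = (`) rename_down ` part_edges \<alpha> \<union> (`) rename_up ` part_edges \<beta>"

text \<open>\<open>pcomp m n k \<alpha> \<beta>\<close> is the product of \<open>\<alpha> \<in> partitions m n\<close> and \<open>\<beta> \<in> partitions n k\<close>.\<close>

definition pcomp :: "nat \<Rightarrow> nat \<Rightarrow> nat \<Rightarrow> part \<Rightarrow> part \<Rightarrow> part" where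
  "pcomp m n k \<alpha> \<beta> =
     {C \<inter> verts m k | C. C \<in> graph_components (product_verts m n k) (product_edges \<alpha> \<beta>)} - {{}}"

section \<open>Planar partitions\<close>

text \<open>\<open>DPrimed\<close> vertices do not occur in drawings; their value is irrelevant.\<close>

fun position :: "vertex \<Rightarrow> real^2" where
  "position (Unprimed x) = vector [real x, 1]"
| "position (Primed x) = vector [real x, 0]"
| "position (DPrimed x) = undefined"

text \<open>A drawing assigns to every edge an arc in the closed rectangle that joins the two ends of the
  edge. An edge passes through no other vertex, and two edges meet at most in their common ends.
  Since the vertices lie on the horizontal sides of the rectangle, edges then meet nowhere in its
  interior. Crossings at non-vertex points of the boundary have to be excluded as well, because
  otherwise edges running along the sides of the rectangle would realise every partition with
  \<open>n = 0\<close>. The rectangle may be degenerate: if \<open>m\<close> and \<open>n\<close> are at most 1 it is a line segment or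
  empty, so edges cannot be required to run in its interior.\<close>

definition drawing ::
  "nat \<Rightarrow> nat \<Rightarrow> vertex set set \<Rightarrow> (vertex set \<Rightarrow> real \<Rightarrow> real^2) \<Rightarrow> bool" where
  "drawing m n E \<gamma> \<longleftrightarrow>
     (\<forall>e\<in>E. arc (\<gamma> e) \<and>
        {pathstart (\<gamma> e), pathfinish (\<gamma> e)} = position ` e \<and>
        path_image (\<gamma> e) \<subseteq> cbox (vector [1, 0]) (vector [real (max m n), 1]) \<and>
        path_image (\<gamma> e) \<inter> position ` verts m n = position ` e) \<and>
     (\<forall>e\<in>E. \<forall>f\<in>E. e \<noteq> f \<longrightarrow>
        path_image (\<gamma> e) \<inter> path_image (\<gamma> f) \<subseteq> position ` (e \<inter> f))"

definition planar :: "nat \<Rightarrow> nat \<Rightarrow> part \<Rightarrow> bool" where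
  "planar m n \<alpha> \<longleftrightarrow>
     (\<exists>E \<gamma>. graph_on (verts m n) E \<and> graph_components (verts m n) E = \<alpha> \<and> drawing m n E \<gamma>)"

text \<open>A category with object set the natural numbers is represented by its family of hom-sets.\<close>

definition PP :: "nat \<Rightarrow> nat \<Rightarrow> part set" where
  "PP m n = {\<alpha> \<in> partitions m n. planar m n \<alpha>}"

definition TL :: "nat \<Rightarrow> nat \<Rightarrow> part set" where
  "TL m n = {\<alpha> \<in> PP m n. \<forall>B\<in>\<alpha>. card B = 2}"

section \<open>Green's relations in a category\<close>

text \<open>For \<open>\<alpha> \<in> K m n\<close> and \<open>\<beta> \<in> K m k\<close>.\<close>

definition greenR :: "(nat \<Rightarrow> nat \<Rightarrow> part set) \<Rightarrow> nat \<Rightarrow> nat \<Rightarrow> nat \<Rightarrow> part \<Rightarrow> part \<Rightarrow> bool" where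
  "greenR K m n k \<alpha> \<beta> \<longleftrightarrow>
     (\<exists>\<gamma>\<in>K k n. \<exists>\<delta>\<in>K n k. \<alpha> = pcomp m k n \<beta> \<gamma> \<and> \<beta> = pcomp m n k \<alpha> \<delta>)"

text \<open>For \<open>\<alpha> \<in> K m n\<close> and \<open>\<beta> \<in> K k n\<close>.\<close>

definition greenL :: "(nat \<Rightarrow> nat \<Rightarrow> part set) \<Rightarrow> nat \<Rightarrow> nat \<Rightarrow> nat \<Rightarrow> part \<Rightarrow> part \<Rightarrow> bool" where
  "greenL K m k n \<alpha> \<beta> \<longleftrightarrow>
     (\<exists>\<gamma>\<in>K m k. \<exists>\<delta>\<in>K k m. \<alpha> = pcomp m k n \<gamma> \<beta> \<and> \<beta> = pcomp k m n \<delta> \<alpha>)"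

section \<open>Semigroups and sandwich semigroups\<close>

text \<open>A semigroup is given by a carrier set \<open>S\<close> and an operation \<open>f\<close>.\<close>

definition idempotents :: "'a set \<Rightarrow> ('a \<Rightarrow> 'a \<Rightarrow> 'a) \<Rightarrow> 'a set" where
  "idempotents S f = {a \<in> S. f a a = a}"

definition Reg :: "'a set \<Rightarrow> ('a \<Rightarrow> 'a \<Rightarrow> 'a) \<Rightarrow> 'a set" where
  "Reg S f = {a \<in> S. \<exists>x\<in>S. a = f (f a x) a}"

inductive_set idem_generated :: "'a set \<Rightarrow> ('a \<Rightarrow> 'a \<Rightarrow> 'a) \<Rightarrow> 'a set"
  for S :: "'a set" and f :: "'a \<Rightarrow> 'a \<Rightarrow> 'a" where
  idem: "a \<in> idempotents S f \<Longrightarrow> a \<in> idem_generated S f"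
| mult: "a \<in> idem_generated S f \<Longrightarrow> b \<in> idem_generated S f \<Longrightarrow> f a b \<in> idem_generated S f"

text \<open>For \<open>\<sigma> \<in> K n m\<close> and \<open>\<alpha>, \<beta> \<in> K m n\<close>.\<close>

definition sandwich :: "nat \<Rightarrow> nat \<Rightarrow> part \<Rightarrow> part \<Rightarrow> part \<Rightarrow> part" where
  "sandwich m n \<sigma> \<alpha> \<beta> = pcomp m m n (pcomp m n m \<alpha> \<sigma>) \<beta>"

definition P_set :: "(nat \<Rightarrow> nat \<Rightarrow> part set) \<Rightarrow> nat \<Rightarrow> nat \<Rightarrow> part \<Rightarrow> part set" where
  "P_set K m n \<sigma> = {\<alpha> \<in> K m n.
     greenR K m m n (pcomp m n m \<alpha> \<sigma>) \<alpha> \<and> greenL K n m n (pcomp n m n \<sigma> \<alpha>) \<alpha>}"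

end

theory Submission
  imports Defs
begin

text \<open>
  The argument separates a formal part about categories from the geometry of planar partitions.

  In any category with split factorisations and idempotent-generated endomorphism monoids, the
  regular elements of every sandwich semigroup are \<open>P\<^sup>\<sigma>\<close> and are products of idempotents
  (\<open>sandwich_regular_idempotent_generated\<close>). Both properties hold if the morphisms are generated by
  caps \<open>c\<^sub>0, c\<^sub>1, ...\<close> and their converses, the cups, subject to \<open>c\<^sub>i c\<^sub>i\<inverse> = 1\<close> and \<open>c\<^sub>i c\<^sub>i\<^sub>+\<^sub>1\<inverse> = 1\<close>
  (\<open>cap_chain\<close>): a morphism is then a composite of cups followed by a composite of caps, which is a
  split factorisation, and an endomorphism \<open>c\<^sub>i\<inverse> f c\<^sub>j\<close> equals \<open>(c\<^sub>i\<inverse> f c\<^sub>i) (c\<^sub>i\<inverse> c\<^sub>j)\<close>, where \<open>c\<^sub>i\<inverse> c\<^sub>j\<close> is a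
  product of idempotents \<open>c\<^sub>k\<inverse> c\<^sub>k\<close> and \<open>f\<close> is a product of idempotents by induction.

  A partition is determined by the set of its block-constant Boolean labelings, which is a relation
  between Boolean words. The product of partitions becomes the composition of these relations
  (\<open>labelings_pcomp\<close>), so it is associative, and the relations required of the caps are identities
  between operations on words. A cap of the Temperley-Lieb category inserts two equal letters; in the
  planar category, caps that insert an arbitrary letter alternate with caps that double a letter.

  Planarity is equivalent to the absence of interleaving blocks in the boundary order of the vertices
  (\<open>planar_part_of\<close>). Crossings are unavoidable for interleaving blocks by the Fashoda theorem; if
  there are none, each block is drawn as a star of chords in a convex lens. A noncrossing partition that no cap or cup can be split off from is an
  identity (\<open>irreducible_identity\<close>), and noncrossing partitions are closed under composition with
  caps and cups.
\<close>

section \<open>Sandwich semigroups in a category\<close>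

text \<open>Let every morphism \<open>\<alpha>\<close> of a category have a split factorisation \<open>\<alpha> = a b\<close>, meaning that \<open>a' a = 1\<close>
  and \<open>b b' = 1\<close> for some \<open>a'\<close> and \<open>b'\<close>, and let every endomorphism monoid be generated by its
  idempotents. Split factorisations make every morphism regular, and this already yields the
  equality of \<open>P_set\<close> and \<open>Reg\<close>. For idempotent generation, \<open>\<sigma> = a b\<close> is factored through \<open>r\<close>; the maps \<open>\<alpha> \<mapsto> b \<alpha> a\<close> and
  \<open>e \<mapsto> b' e a'\<close> between the sandwich semigroup and the monoid at \<open>r\<close> are homomorphisms, so a
  factorisation of \<open>b \<alpha> a\<close> into idempotents lifts to one of \<open>b' b \<alpha> a a'\<close>. A regular \<open>\<alpha>\<close> differs from
  that element only by idempotent factors on both sides.\<close>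

lemma sandwich_regular_idempotent_generated:
  fixes K :: "nat \<Rightarrow> nat \<Rightarrow> part set" and unit_diagram :: "nat \<Rightarrow> part"
  assumes clo: "\<And>m n k \<alpha> \<beta>. \<alpha> \<in> K m n \<Longrightarrow> \<beta> \<in> K n k \<Longrightarrow> pcomp m n k \<alpha> \<beta> \<in> K m k"
    and assoc: "\<And>m n k l \<alpha> \<beta> \<gamma>. \<alpha> \<in> K m n \<Longrightarrow> \<beta> \<in> K n k \<Longrightarrow> \<gamma> \<in> K k l \<Longrightarrow>
      pcomp m k l (pcomp m n k \<alpha> \<beta>) \<gamma> = pcomp m n l \<alpha> (pcomp n k l \<beta> \<gamma>)"
    and idl: "\<And>m n \<alpha>. \<alpha> \<in> K m n \<Longrightarrow> pcomp m m n (unit_diagram m) \<alpha> = \<alpha>"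
    and idr: "\<And>m n \<alpha>. \<alpha> \<in> K m n \<Longrightarrow> pcomp m n n \<alpha> (unit_diagram n) = \<alpha>"
    and split: "\<And>m n \<alpha>. \<alpha> \<in> K m n \<Longrightarrow> \<exists>r. \<exists>a\<in>K m r. \<exists>b\<in>K r n. \<exists>a'\<in>K r m. \<exists>b'\<in>K n r.
      pcomp r m r a' a = unit_diagram r \<and> pcomp r n r b b' = unit_diagram r \<and> \<alpha> = pcomp m r n a b"
    and gen: "\<And>n \<alpha>. \<alpha> \<in> K n n \<Longrightarrow> \<alpha> \<in> idem_generated (K n n) (pcomp n n n)"
    and \<sigma>: "\<sigma> \<in> K n m"
  shows "idem_generated (K m n) (sandwich m n \<sigma>) = P_set K m n \<sigma>"
    and "P_set K m n \<sigma> = Reg (K m n) (sandwich m n \<sigma>)"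
proof -
  let ?S = "sandwich m n \<sigma>"
  have S: "?S \<alpha> \<beta> = pcomp m n n \<alpha> (pcomp n m n \<sigma> \<beta>)" if "\<alpha> \<in> K m n" "\<beta> \<in> K m n" for \<alpha> \<beta>
    using that \<sigma> by (simp add: sandwich_def assoc)
  have S_mem: "?S \<alpha> \<beta> \<in> K m n" if "\<alpha> \<in> K m n" "\<beta> \<in> K m n" for \<alpha> \<beta>
    using that \<sigma> by (simp add: S clo)
  have S_assoc: "?S (?S \<alpha> \<beta>) \<gamma> = ?S \<alpha> (?S \<beta> \<gamma>)"
    if "\<alpha> \<in> K m n" "\<beta> \<in> K m n" "\<gamma> \<in> K m n" for \<alpha> \<beta> \<gamma>
    using that \<sigma> by (simp add: S S_mem assoc clo)
  have regular: "\<exists>\<alpha>'\<in>K l k. pcomp k l l \<alpha> (pcomp l k l \<alpha>' \<alpha>) = \<alpha>" if \<alpha>: "\<alpha> \<in> K k l" for k l \<alpha>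
  proof -
    obtain r a b a' b' where *: "a \<in> K k r" "b \<in> K r l" "a' \<in> K r k" "b' \<in> K l r"
        "pcomp r k r a' a = unit_diagram r" "pcomp r l r b b' = unit_diagram r" "\<alpha> = pcomp k r l a b"
      using split[OF \<alpha>] by blast
    have "pcomp r l y b (pcomp l r y b' z) = z" "pcomp r k y a' (pcomp k r y a z) = z"
      if "z \<in> K r y" for y z
      using that * by (metis assoc idl)+
    then have "pcomp k l l \<alpha> (pcomp l k l (pcomp l r k b' a') \<alpha>) = \<alpha>"
      using * by (simp add: assoc clo)
    then show ?thesis using * clo by blast
  qed
  \<comment> \<open>On hom-sets, Green's conditions say that \<open>\<alpha>\<close> has a one-sided identity on either side.\<close>
  have P_iff: "\<alpha> \<in> P_set K m n \<sigma> \<longleftrightarrow> \<alpha> \<in> K m n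
      \<and> (\<exists>\<delta>\<in>K m n. \<alpha> = ?S \<alpha> \<delta>) \<and> (\<exists>\<eta>\<in>K m n. \<alpha> = ?S \<eta> \<alpha>)" for \<alpha>
    using \<sigma> by (auto simp: P_set_def greenR_def greenL_def sandwich_def assoc clo) blast+
  show P_Reg: "P_set K m n \<sigma> = Reg (K m n) ?S"
  proof (intro equalityI subsetI)
    fix \<alpha> assume "\<alpha> \<in> P_set K m n \<sigma>"
    then obtain \<delta> \<eta> where \<alpha>: "\<alpha> \<in> K m n" "\<delta> \<in> K m n" "\<eta> \<in> K m n" "\<alpha> = ?S \<alpha> \<delta>" "\<alpha> = ?S \<eta> \<alpha>"
      by (auto simp: P_iff)
    obtain \<alpha>' where \<alpha>': "\<alpha>' \<in> K n m" "pcomp m n n \<alpha> (pcomp n m n \<alpha>' \<alpha>) = \<alpha>"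
      using regular[OF \<alpha>(1)] by blast
    let ?x = "pcomp m n n \<delta> (pcomp n m n \<alpha>' \<eta>)"
    have "?S (?S \<alpha> ?x) \<alpha> = pcomp m n n (?S \<alpha> \<delta>) (pcomp n m n \<alpha>' (?S \<eta> \<alpha>))"
      using \<alpha>(1-3) \<alpha>'(1) \<sigma> by (simp add: sandwich_def assoc clo)
    also have "\<dots> = \<alpha>" using \<alpha> \<alpha>' by simp
    finally show "\<alpha> \<in> Reg (K m n) ?S"
      using \<alpha>(1-3) \<alpha>'(1) by (auto simp: Reg_def clo intro!: bexI[of _ ?x])
  next
    fix \<alpha> assume "\<alpha> \<in> Reg (K m n) ?S"
    then obtain x where x: "\<alpha> \<in> K m n" "x \<in> K m n" "\<alpha> = ?S (?S \<alpha> x) \<alpha>"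
      by (auto simp: Reg_def)
    then have "\<alpha> = ?S \<alpha> (?S x \<alpha>)" using S_assoc by metis
    then show "\<alpha> \<in> P_set K m n \<sigma>" using x S_mem unfolding P_iff by blast
  qed
  show "idem_generated (K m n) ?S = P_set K m n \<sigma>"
  proof (intro equalityI subsetI)
    fix \<alpha> assume "\<alpha> \<in> idem_generated (K m n) ?S"
    then show "\<alpha> \<in> P_set K m n \<sigma>"
    proof induction
      case (idem \<alpha>)
      then show ?case by (auto simp: P_iff idempotents_def)
    next
      case (mult \<alpha> \<beta>)
      then obtain \<delta> \<eta> where "\<alpha> \<in> K m n" "\<beta> \<in> K m n" "\<delta> \<in> K m n" "\<eta> \<in> K m n"
          "\<beta> = ?S \<beta> \<delta>" "\<alpha> = ?S \<eta> \<alpha>"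
        unfolding P_iff by blast
      then show ?case unfolding P_iff by (metis S_assoc S_mem)
    qed
  next
    fix \<alpha> assume "\<alpha> \<in> P_set K m n \<sigma>"
    then obtain x where x: "\<alpha> \<in> K m n" "x \<in> K m n" "\<alpha> = ?S (?S \<alpha> x) \<alpha>"
      by (auto simp: P_Reg Reg_def)
    obtain r a b a' b' where *: "a \<in> K n r" "b \<in> K r m" "a' \<in> K r n" "b' \<in> K m r"
        "pcomp r n r a' a = unit_diagram r" "pcomp r m r b b' = unit_diagram r" "\<sigma> = pcomp n r m a b"
      using split[OF \<sigma>] by blast
    \<comment> \<open>\<open>lift\<close> is a homomorphism from the monoid at \<open>r\<close> to the sandwich semigroup.\<close>
    define lift where "lift e = pcomp m r n b' (pcomp r r n e a')" for e
    have lift_mem: "lift e \<in> K m n" if "e \<in> K r r" for e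
      using that * by (simp add: lift_def clo)
    have bb: "pcomp r m k b (pcomp m r k b' y) = y" if "y \<in> K r k" for k y
      using that * by (metis assoc idl)
    have aa: "pcomp r n k a' (pcomp n r k a y) = y" if "y \<in> K r k" for k y
      using that * by (metis assoc idl)
    have lift_mult: "?S (lift e) (lift f) = lift (pcomp r r r e f)"
      if "e \<in> K r r" "f \<in> K r r" for e f
      using that * by (simp add: sandwich_def lift_def assoc clo bb aa)
    have lift_gen: "lift e \<in> idem_generated (K m n) ?S" if "e \<in> K r r" for e
    proof -
      have "e \<in> K r r \<and> lift e \<in> idem_generated (K m n) ?S"
        using gen[OF that]
      proof induction
        case (idem e)
        then have "lift e \<in> idempotents (K m n) ?S"
          by (simp add: idempotents_def lift_mem lift_mult)
        with idem show ?case by (auto simp: idempotents_def intro: idem_generated.idem)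
      next
        case (mult e f)
        then show ?case by (metis clo lift_mult idem_generated.mult)
      qed
      then show ?thesis ..
    qed
    let ?f = "?S \<alpha> x" and ?g = "?S x \<alpha>"
    let ?e = "pcomp r m r b (pcomp m n r \<alpha> a)"
    have e: "?e \<in> K r r" using x * by (simp add: clo)
    have fg: "?f \<in> idempotents (K m n) ?S" "?g \<in> idempotents (K m n) ?S"
      unfolding idempotents_def using x S_mem S_assoc by (smt (verit) mem_Collect_eq)+
    \<comment> \<open>Between two copies of \<open>\<sigma>\<close>, the lift of \<open>b \<alpha> a\<close> cannot be distinguished from \<open>\<alpha>\<close>.\<close>
    have \<sigma>_lift: "pcomp n m m \<sigma> (pcomp m n m (lift ?e) \<sigma>) = pcomp n m m \<sigma> (pcomp m n m \<alpha> \<sigma>)"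
      using x * by (simp add: lift_def assoc clo bb aa)
    have "?S (?S ?f (lift ?e)) ?g
        = pcomp m n n \<alpha> (pcomp n m n \<sigma> (pcomp m n n x (pcomp n m n
            (pcomp n m m \<sigma> (pcomp m n m (lift ?e) \<sigma>)) (pcomp m n n x (pcomp n m n \<sigma> \<alpha>)))))"
      using x \<sigma> lift_mem[OF e] by (simp add: sandwich_def assoc clo)
    also have "\<dots> = ?S (?S ?f \<alpha>) ?g"
      unfolding \<sigma>_lift using x \<sigma> by (simp add: sandwich_def assoc clo)
    also have "\<dots> = \<alpha>"
      using x S_assoc S_mem by metis
    finally show "\<alpha> \<in> idem_generated (K m n) ?S"
      using fg lift_gen[OF e] by (metis idem_generated.intros)
  qed
qed

section \<open>Categories generated by a chain of caps\<close>

text \<open>\<open>H\<close> gives the hom-sets of a category of relations, and \<open>c m i\<close> (for \<open>i < N m\<close>) are the caps from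
  \<open>m\<close> to \<open>m + s\<close>, whose converses are the cups. Each cap is a section of its own cup and of the cup
  that follows it in the chain. Closure of \<open>H\<close> is only required for composition with a cap or cup on
  the left. By \<open>reduce\<close>, a morphism other than an identity factors through a cap or a cup.\<close>

locale cap_chain =
  fixes H :: "nat \<Rightarrow> nat \<Rightarrow> 'a rel set" and I :: "nat \<Rightarrow> 'a rel" and s :: nat
    and N :: "nat \<Rightarrow> nat" and c :: "nat \<Rightarrow> nat \<Rightarrow> 'a rel"
  assumes s_pos: "0 < s"
    and id_mem: "I m \<in> H m m"
    and id_left: "R \<in> H m n \<Longrightarrow> I m O R = R"
    and conv: "R \<in> H m n \<Longrightarrow> R\<inverse> \<in> H n m"
    and cap_mem: "i < N m \<Longrightarrow> c m i \<in> H m (m + s)"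
    and cap_left: "i < N m \<Longrightarrow> R \<in> H (m + s) n \<Longrightarrow> c m i O R \<in> H m n"
    and cup_left: "i < N m \<Longrightarrow> R \<in> H m n \<Longrightarrow> (c m i)\<inverse> O R \<in> H (m + s) n"
    and cap_cup: "i < N m \<Longrightarrow> c m i O (c m i)\<inverse> = I m"
    and cap_cup_Suc: "Suc i < N m \<Longrightarrow> c m i O (c m (Suc i))\<inverse> = I m"
    and reduce: "R \<in> H m n \<Longrightarrow> m = n \<and> R = I m
      \<or> (\<exists>k i. m = k + s \<and> i < N k \<and> R = (c k i)\<inverse> O (c k i O R))
      \<or> (\<exists>k i. n = k + s \<and> i < N k \<and> R = (R O (c k i)\<inverse>) O c k i)"
begin

lemma id_conv: "(I m)\<inverse> = I m"
proof -
  have "I m O (I m)\<inverse> = (I m)\<inverse>" by (rule id_left[OF conv[OF id_mem]])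
  then show ?thesis by (metis converse_converse converse_relcomp)
qed

lemma id_right: "R \<in> H m n \<Longrightarrow> R O I n = R"
  by (metis converse_converse converse_relcomp conv id_conv id_left)

lemma cap_right: "i < N n \<Longrightarrow> R \<in> H m n \<Longrightarrow> R O c n i \<in> H m (n + s)"
  by (metis converse_converse converse_relcomp conv cup_left)

lemma cup_right: "i < N n \<Longrightarrow> R \<in> H m (n + s) \<Longrightarrow> R O (c n i)\<inverse> \<in> H m n"
  by (metis converse_converse converse_relcomp conv cap_left)

text \<open>A cascade from \<open>r\<close> to \<open>m\<close> is a composite of caps.\<close>

inductive cascade :: "nat \<Rightarrow> nat \<Rightarrow> 'a rel \<Rightarrow> bool" for r where
  base: "cascade r r (I r)"
| step: "cascade r m a \<Longrightarrow> i < N m \<Longrightarrow> cascade r (m + s) (a O c m i)"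

lemma cascade_mem: "cascade r m a \<Longrightarrow> a \<in> H r m"
  by (induction rule: cascade.induct) (auto intro: id_mem cap_right)

lemma cascade_inverse: "cascade r m a \<Longrightarrow> a O a\<inverse> = I r"
proof (induction rule: cascade.induct)
  case base
  then show ?case by (simp add: id_conv id_left[OF id_mem])
next
  case (step m a i)
  have "(a O c m i) O (a O c m i)\<inverse> = a O (c m i O (c m i)\<inverse>) O a\<inverse>"
    by (simp add: converse_relcomp O_assoc)
  also have "\<dots> = a O a\<inverse>"
    using step by (simp add: cap_cup id_left[OF conv[OF cascade_mem]])
  finally show ?case using step by simp
qed

lemma cascade_left:
  "cascade r m a \<Longrightarrow> (\<forall>n. \<forall>R\<in>H m n. a O R \<in> H r n) \<and> (\<forall>n. \<forall>R\<in>H r n. a\<inverse> O R \<in> H m n)"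
proof (induction rule: cascade.induct)
  case base
  then show ?case by (auto simp: id_conv id_left)
next
  case (step m a i)
  then show ?case
    by (auto simp: converse_relcomp O_assoc intro!: cap_left cup_left)
qed

lemma cascade_le: "cascade r m a \<Longrightarrow> r \<le> m"
  by (induction rule: cascade.induct) auto

lemma cascade_factorisation:
  "R \<in> H m n \<Longrightarrow> \<exists>r a b. cascade r m a \<and> cascade r n b \<and> R = a\<inverse> O b"
proof (induction "m + n" arbitrary: m n R rule: less_induct)
  case less
  from reduce[OF less.prems] consider "m = n" "R = I m"
    | k i where "m = k + s" "i < N k" "R = (c k i)\<inverse> O (c k i O R)"
    | k i where "n = k + s" "i < N k" "R = (R O (c k i)\<inverse>) O c k i" by blast
  then show ?case
  proof cases
    case 1
    then show ?thesis by (metis base id_conv id_left id_mem)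
  next
    case (2 k i)
    then have "c k i O R \<in> H k n" using cap_left less.prems by blast
    with less.hyps[of k n "c k i O R"] 2 s_pos obtain r a b
      where ab: "cascade r k a" "cascade r n b" "c k i O R = a\<inverse> O b" by auto
    then have "R = (a O c k i)\<inverse> O b"
      using 2 by (metis converse_relcomp O_assoc)
    with ab 2 show ?thesis by (metis step)
  next
    case (3 k i)
    then have "R O (c k i)\<inverse> \<in> H m k" using cup_right less.prems by blast
    with less.hyps[of m k "R O (c k i)\<inverse>"] 3 s_pos obtain r a b
      where ab: "cascade r m a" "cascade r k b" "R O (c k i)\<inverse> = a\<inverse> O b" by auto
    then have "R = a\<inverse> O (b O c k i)"
      using 3 by (metis O_assoc)
    with ab 3 show ?thesis by (metis step)
  qed
qed

lemma comp_mem: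
  assumes "R \<in> H m n" "S \<in> H n k" shows "R O S \<in> H m k"
proof -
  obtain r a b where "cascade r m a" "cascade r n b" "R = a\<inverse> O b"
    using cascade_factorisation[OF assms(1)] by blast
  then show ?thesis using assms(2) cascade_left by (simp add: O_assoc)
qed

lemma split_factorisation:
  assumes "R \<in> H m n"
  shows "\<exists>r. \<exists>a\<in>H r m. \<exists>b\<in>H r n. a O a\<inverse> = I r \<and> b O b\<inverse> = I r \<and> R = a\<inverse> O b"
proof -
  obtain r a b where "cascade r m a" "cascade r n b" "R = a\<inverse> O b"
    using cascade_factorisation[OF assms] by blast
  then show ?thesis
    by (intro exI[of _ r] bexI[of _ a] bexI[of _ b]) (simp_all add: cascade_inverse cascade_mem)
qed

text \<open>Since \<open>c c\<inverse> = 1\<close>, \<open>f \<mapsto> c\<inverse> f c\<close> is a homomorphism between endomorphism monoids.\<close>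

lemma cup_cap_idem:
  assumes "i < N k" "f \<in> idempotents (H k k) (O)"
  shows "(c k i)\<inverse> O f O c k i \<in> idempotents (H (k + s) (k + s)) (O)"
proof -
  have f: "f \<in> H k k" "f O f = f" using assms(2) by (auto simp: idempotents_def)
  have "((c k i)\<inverse> O f O c k i) O ((c k i)\<inverse> O f O c k i)
      = (c k i)\<inverse> O f O (c k i O (c k i)\<inverse>) O f O c k i" by (simp add: O_assoc)
  also have "\<dots> = (c k i)\<inverse> O (f O f) O c k i"
    using assms(1) by (simp add: cap_cup id_left[OF cap_right[OF assms(1) f(1)]] O_assoc)
  finally show ?thesis
    using f assms(1) by (auto simp: idempotents_def cup_left cap_right)
qed

lemma cup_cap_idem_generated:
  assumes "i < N k" "f \<in> idem_generated (H k k) (O)"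
  shows "(c k i)\<inverse> O f O c k i \<in> idem_generated (H (k + s) (k + s)) (O) \<and> f \<in> H k k"
  using assms(2)
proof (induction rule: idem_generated.induct)
  case (idem f)
  then show ?case
    using cup_cap_idem[OF assms(1)] by (auto intro: idem_generated.idem simp: idempotents_def)
next
  case (mult f g)
  have "((c k i)\<inverse> O f O c k i) O ((c k i)\<inverse> O g O c k i)
      = (c k i)\<inverse> O f O (c k i O (c k i)\<inverse>) O g O c k i" by (simp add: O_assoc)
  also have "\<dots> = (c k i)\<inverse> O (f O g) O c k i"
    using assms(1) mult by (simp add: cap_cup id_left[OF cap_right] O_assoc)
  finally show ?case using mult by (metis idem_generated.mult comp_mem)
qed

lemma id_idem: "I k \<in> idempotents (H k k) (O)"
  by (simp add: idempotents_def id_mem id_left[OF id_mem])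

lemma cup_cap_adjacent:
  assumes "i < N k"
  shows "(c k i)\<inverse> O c k i \<in> idem_generated (H (k + s) (k + s)) (O)"
  using cup_cap_idem[OF assms id_idem] assms
  by (auto simp: id_left[OF cap_mem] intro: idem_generated.idem)

text \<open>The relation \<open>c\<^sub>j c\<^sub>j\<^sub>+\<^sub>1\<inverse> = 1\<close> lets \<open>c\<^sub>i\<inverse> c\<^sub>j\<close> be written as the product of the idempotents
  \<open>c\<^sub>k\<inverse> c\<^sub>k\<close> for \<open>i \<le> k \<le> j\<close>.\<close>

lemma cup_cap_upwards:
  assumes "i \<le> j" "j < N k"
  shows "(c k i)\<inverse> O c k j \<in> idem_generated (H (k + s) (k + s)) (O)"
  using assms
proof (induction j rule: dec_induct)
  case base
  then show ?case by (rule cup_cap_adjacent)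
next
  case (step j)
  have "((c k i)\<inverse> O c k j) O ((c k (Suc j))\<inverse> O c k (Suc j))
      = (c k i)\<inverse> O (c k j O (c k (Suc j))\<inverse>) O c k (Suc j)" by (simp add: O_assoc)
  also have "\<dots> = (c k i)\<inverse> O c k (Suc j)"
    using step by (simp add: cap_cup_Suc id_left[OF cap_mem])
  finally show ?case using step by (metis idem_generated.mult cup_cap_adjacent Suc_lessD)
qed

lemma idem_generated_conv:
  assumes "f \<in> idem_generated (H k k) (O)"
  shows "f\<inverse> \<in> idem_generated (H k k) (O)"
  using assms
proof (induction rule: idem_generated.induct)
  case (idem a)
  then have "a\<inverse> \<in> idempotents (H k k) (O)"
    by (auto simp: idempotents_def conv converse_relcomp[symmetric])
  then show ?case by (rule idem_generated.idem)
next
  case (mult a b)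
  then show ?case by (simp add: converse_relcomp idem_generated.mult)
qed

lemma cup_cap:
  assumes "i < N k" "j < N k"
  shows "(c k i)\<inverse> O c k j \<in> idem_generated (H (k + s) (k + s)) (O)"
proof (cases "i \<le> j")
  case True
  then show ?thesis using assms cup_cap_upwards by blast
next
  case False
  then have "((c k j)\<inverse> O c k i)\<inverse> \<in> idem_generated (H (k + s) (k + s)) (O)"
    using assms by (intro idem_generated_conv cup_cap_upwards) auto
  then show ?thesis by (simp add: converse_relcomp)
qed

text \<open>A non-identity endomorphism is \<open>c\<^sub>i\<inverse> f c\<^sub>j = (c\<^sub>i\<inverse> f c\<^sub>i) (c\<^sub>i\<inverse> c\<^sub>j)\<close> for a smaller endomorphism \<open>f\<close>, because
  its two cascades have the same source and target and hence the same length.\<close>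

lemma idempotent_generated: "R \<in> H n n \<Longrightarrow> R \<in> idem_generated (H n n) (O)"
proof (induction n arbitrary: R rule: less_induct)
  case (less n)
  obtain r a b where ab: "cascade r n a" "cascade r n b" "R = a\<inverse> O b"
    using cascade_factorisation[OF less.prems] by blast
  show ?case
    using ab(1)
  proof cases
    case base
    from ab(2) have "b = I n"
    proof cases
      case (step m a i)
      then show ?thesis using cascade_le[of r m a] base s_pos by auto
    qed (use base in auto)
    with base ab(3) have "R = I n" by (simp add: id_conv id_left[OF id_mem])
    then show ?thesis by (simp add: id_idem idem_generated.idem)
  next
    case (step k a' i)
    from ab(2) obtain b' j where b: "b = b' O c k j" "j < N k" "cascade r k b'"
    proof cases
      case base
      then show ?thesis using cascade_le[OF step(3)] step(1) s_pos by auto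
    next
      case (step k' b' j)
      then show ?thesis using that \<open>n = k + s\<close> by simp
    qed
    have mem: "a'\<inverse> O b' \<in> H k k"
      using step b cascade_left cascade_mem by blast
    then have f: "a'\<inverse> O b' \<in> idem_generated (H k k) (O)"
      using less.IH[of k] step(1) s_pos by simp
    have "((c k i)\<inverse> O (a'\<inverse> O b') O c k i) O ((c k i)\<inverse> O c k j)
       = (c k i)\<inverse> O (a'\<inverse> O b') O (c k i O (c k i)\<inverse>) O c k j" by (simp add: O_assoc)
    also have "\<dots> = R"
      using step b ab(3) by (simp add: cap_cup id_left[OF cap_mem] converse_relcomp O_assoc)
    finally show ?thesis
      using cup_cap_idem_generated[OF step(4) f] cup_cap[OF step(4) b(2)] step(1)
      by (metis idem_generated.mult)
  qed
qed

end

section \<open>Noncrossing words\<close>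

text \<open>A partition of \<open>{0..<k}\<close> is encoded by a word of length \<open>k\<close> whose letters, called colours, name the
  blocks. It is noncrossing if no two blocks interleave.\<close>

definition noncrossing :: "'c list \<Rightarrow> bool" where
  "noncrossing w \<longleftrightarrow> (\<forall>a b c d. a < b \<longrightarrow> b < c \<longrightarrow> c < d \<longrightarrow> d < length w \<longrightarrow>
     w ! a = w ! c \<longrightarrow> w ! b = w ! d \<longrightarrow> w ! a = w ! b)"

lemma noncrossingD:
  "noncrossing w \<Longrightarrow> a < b \<Longrightarrow> b < c \<Longrightarrow> c < d \<Longrightarrow> d < length w \<Longrightarrow>
     w ! a = w ! c \<Longrightarrow> w ! b = w ! d \<Longrightarrow> w ! a = w ! b"
  unfolding noncrossing_def by blast

lemma noncrossing_rev: "noncrossing w \<Longrightarrow> noncrossing (rev w)"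
  unfolding noncrossing_def[of "rev w"]
proof (intro allI impI)
  fix a b c d
  assume "noncrossing w" and *: "a < b" "b < c" "c < d" "d < length (rev w)"
    "rev w ! a = rev w ! c" "rev w ! b = rev w ! d"
  then show "rev w ! a = rev w ! b"
    using noncrossingD[of w "length w - Suc d" "length w - Suc c" "length w - Suc b" "length w - Suc a"]
    by (auto simp: rev_nth)
qed

text \<open>Weak monotonicity suffices: positions that \<open>h\<close> merges have equal colours.\<close>

lemma noncrossing_reindex:
  assumes "noncrossing w"
    and h: "\<And>i. i < length w' \<Longrightarrow> h i < length w \<and> w' ! i = w ! h i"
    and mono: "\<And>i j. i < j \<Longrightarrow> j < length w' \<Longrightarrow> h i \<le> h j"
  shows "noncrossing w'"
  unfolding noncrossing_def
proof (intro allI impI)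
  fix a b c d
  assume *: "a < b" "b < c" "c < d" "d < length w'" "w' ! a = w' ! c" "w' ! b = w' ! d"
  have eq: "w' ! a = w ! h a" "w' ! b = w ! h b" "w' ! c = w ! h c" "w' ! d = w ! h d"
    using h * by auto
  have "h a \<le> h b" "h b \<le> h c" "h c \<le> h d" "h d < length w" using mono h * by auto
  then consider "h a = h b" | "h b = h c" | "h c = h d" | "h a < h b" "h b < h c" "h c < h d"
    by linarith
  then show "w' ! a = w' ! b"
  proof cases
    case 4
    then show ?thesis
      using noncrossingD[OF assms(1) 4 \<open>h d < length w\<close>] * eq by auto
  qed (use * eq in auto)
qed

lemma noncrossing_delete: "noncrossing (u @ [x] @ v) \<Longrightarrow> noncrossing (u @ v)"
  by (erule noncrossing_reindex[where h = "\<lambda>i. if i < length u then i else Suc i"])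
    (auto simp: nth_append Suc_diff_le nth_Cons')

lemma noncrossing_duplicate:
  assumes "noncrossing (u @ [x] @ v)"
  shows "noncrossing (u @ [x, x] @ v)"
proof (rule noncrossing_reindex[OF assms])
  let ?h = "\<lambda>i. if i \<le> length u then i else i - 1"
  fix i j
  show "?h i < length (u @ [x] @ v) \<and> (u @ [x, x] @ v) ! i = (u @ [x] @ v) ! ?h i"
    if "i < length (u @ [x, x] @ v)"
  proof -
    consider "i < length u" | "i = length u" | "i = Suc (length u)"
      | k where "i = length u + Suc (Suc k)"
      by (metis less_imp_Suc_add add_Suc_right linorder_neqE_nat not_less_eq less_antisym)
    then show ?thesis using that by cases (auto simp: nth_append)
  qed
  show "?h i \<le> ?h j" if "i < j" using that by auto
qed

lemma noncrossing_insert: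
  assumes "noncrossing (u @ v)" "x \<notin> set u" "x \<notin> set v"
  shows "noncrossing (u @ [x] @ v)"
  unfolding noncrossing_def
proof (intro allI impI)
  let ?w = "u @ [x] @ v"
  fix a b c d
  assume *: "a < b" "b < c" "c < d" "d < length ?w" "?w ! a = ?w ! c" "?w ! b = ?w ! d"
  define h where "h i = (if i < length u then i else i - 1)" for i
  have x: "?w ! i \<noteq> x" if "i < length ?w" "i \<noteq> length u" for i
    using that assms(2,3) by (auto simp: nth_append nth_Cons' in_set_conv_nth)
  have "a \<noteq> length u" "b \<noteq> length u" "c \<noteq> length u" "d \<noteq> length u"
    using x[of a] x[of b] x[of c] x[of d] * by (auto simp: nth_append)
  moreover have "?w ! i = (u @ v) ! h i" if "i \<noteq> length u" for i
    using that by (auto simp: h_def nth_append nth_Cons')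
  moreover have "h a < h b" "h b < h c" "h c < h d" "h d < length (u @ v)"
    using * calculation(1-4) by (auto simp: h_def)
  ultimately show "?w ! a = ?w ! b"
    using noncrossingD[OF assms(1), of "h a" "h b" "h c" "h d"] * by simp
qed

text \<open>Recolouring that gives the colour \<open>y\<close> the name \<open>x\<close>, so that these two blocks are merged.\<close>

definition identify :: "'a \<Rightarrow> 'a \<Rightarrow> 'a \<Rightarrow> 'a" where
  "identify x y z = (if z = y then x else z)"

lemma identify_simps [simp]: "identify x y x = x" "identify x y y = x" "identify x x = id"
  by (auto simp: identify_def fun_eq_iff)

text \<open>Merging the blocks of two neighbouring positions creates no crossing: if a third block separates
  some position of the merged block from another, then it already crosses one of the two blocks,
  since it cannot pass between the neighbours.\<close>

lemma noncrossing_identify: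
  assumes "noncrossing (u @ [x, y] @ v)"
  shows "noncrossing (map (identify x y) (u @ [x, y] @ v))"
proof -
  let ?w = "u @ [x, y] @ v" and ?s = "identify x y"
  let ?p = "length u"
  have p: "?w ! ?p = x" "?w ! Suc ?p = y" "Suc ?p < length ?w" by (auto simp: nth_append)
  note nc = noncrossingD[OF assms]
  have separated: False
    if "j < k" "k < l" "l < length ?w" "?w ! j = ?w ! l" "?w ! j \<notin> {x, y}"
      "i < j \<or> l < i" "i < length ?w" "?w ! i \<in> {x, y}" "?w ! k \<in> {x, y}" for i j k l
  proof -
    have "j \<noteq> ?p" "j \<noteq> Suc ?p" "l \<noteq> ?p" "l \<noteq> Suc ?p" using that p by auto
    then consider "j < ?p" "Suc ?p < l" | "Suc ?p < j" | "l < ?p" by linarith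
    then show False
    proof cases
      case 1
      then obtain q where q: "j < q" "q < l" "?w ! q = ?w ! i"
        using p \<open>?w ! i \<in> {x, y}\<close> by (metis insert_iff singletonD less_SucI Suc_lessD)
      show False
        using nc[of i j q l] nc[of j q l i] q that by auto
    next
      case 2
      then obtain q where "q < j" "?w ! q = ?w ! k"
        using p \<open>?w ! k \<in> {x, y}\<close> by (metis insert_iff singletonD Suc_lessD)
      then show False using nc[of q j k l] that by auto
    next
      case 3
      then obtain q where "l < q" "?w ! q = ?w ! k" "q < length ?w"
        using p \<open>?w ! k \<in> {x, y}\<close> by (metis insert_iff singletonD less_SucI Suc_lessD)
      then show False using nc[of j k l q] that by auto
    qed
  qed
  show ?thesis
    unfolding noncrossing_def
  proof (intro allI impI)
    fix a b c d
    assume *: "a < b" "b < c" "c < d" "d < length (map ?s ?w)"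
      "map ?s ?w ! a = map ?s ?w ! c" "map ?s ?w ! b = map ?s ?w ! d"
    have d: "d < length ?w" using * by simp
    have s: "map ?s ?w ! i = ?s (?w ! i)" if "i \<le> d" for i using that d by (intro nth_map) simp
    have eq: "?s (?w ! a) = ?s (?w ! c)" "?s (?w ! b) = ?s (?w ! d)"
      using * s by auto
    show "map ?s ?w ! a = map ?s ?w ! b"
    proof (rule ccontr)
      assume "map ?s ?w ! a \<noteq> map ?s ?w ! b"
      then have ne: "?s (?w ! a) \<noteq> ?s (?w ! b)" using * s by auto
      consider "?w ! a = ?w ! c" "?w ! b = ?w ! d"
        | "?w ! a = ?w ! c" "?w ! b \<in> {x, y}" "?w ! d \<in> {x, y}" "?w ! a \<notin> {x, y}"
        | "?w ! a \<in> {x, y}" "?w ! c \<in> {x, y}" "?w ! b = ?w ! d" "?w ! b \<notin> {x, y}"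
        using eq ne unfolding identify_def by (auto split: if_splits)
      then show False
      proof cases
        case 1
        then show ?thesis using nc[OF *(1-3) d] ne by simp
      next
        case 2
        then show ?thesis using separated[of a b c d] * d by auto
      next
        case 3
        then show ?thesis using separated[of b c d a] * d by auto
      qed
    qed
  qed
qed

section \<open>Relations between Boolean words\<close>

text \<open>The partition whose upper vertices have colours \<open>fs\<close> and whose lower vertices have colours \<open>gs\<close>,
  given as the relation formed by its block-constant Boolean labelings. In this form the product of
  partitions is the composition of relations.\<close>

definition rel :: "nat list \<Rightarrow> nat list \<Rightarrow> bool list rel" where
  "rel fs gs = {(map h fs, map h gs) | h. True}"

lemma rel_converse: "(rel fs gs)\<inverse> = rel gs fs"
  by (auto simp: rel_def)

text \<open>\<open>del p\<close> deletes the letter at position \<open>p\<close>, and \<open>dup p\<close> doubles it.\<close>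

definition del :: "nat \<Rightarrow> 'a list \<Rightarrow> 'a list" where
  "del p w = take p w @ drop (Suc p) w"

definition dup :: "nat \<Rightarrow> 'a list \<Rightarrow> 'a list" where
  "dup p w = take (Suc p) w @ drop p w"

lemma length_del: "p < length w \<Longrightarrow> length (del p w) = length w - 1"
  by (auto simp: del_def)

lemma length_dup: "p < length w \<Longrightarrow> length (dup p w) = Suc (length w)"
  by (auto simp: dup_def)

lemma del_map: "del p (map h w) = map h (del p w)"
  by (simp add: del_def take_map drop_map)

lemma dup_map: "dup p (map h w) = map h (dup p w)"
  by (simp add: dup_def take_map drop_map)

lemma del_append [simp]: "del (length u) (u @ x # v) = u @ v"
  by (simp add: del_def)

lemma dup_append [simp]: "dup (length u) (u @ x # v) = u @ x # x # v"
  by (simp add: dup_def)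

lemma del_append_Suc: "del (Suc (length u)) (u @ x # y # v) = u @ x # v"
  by (simp add: del_def)

lemma split_at_nth:
  assumes "p < length w" obtains u x v where "w = u @ x # v" "length u = p"
  using that[of "take p w" "w ! p" "drop (Suc p) w"] assms by (simp add: id_take_nth_drop[symmetric])

lemma split_at_nth2:
  assumes "Suc p < length w" obtains u x y v where "w = u @ x # y # v" "length u = p"
  using that[of "take p w" "w ! p" "w ! Suc p" "drop (Suc (Suc p)) w"] assms
  by (simp add: Cons_nth_drop_Suc)

lemma del_dup: "p < length w \<Longrightarrow> del p (dup p w) = w"
  by (elim split_at_nth) auto

lemma del_Suc_dup: "p < length w \<Longrightarrow> del (Suc p) (dup p w) = w"
  by (elim split_at_nth) (auto simp: del_append_Suc)

lemma dup_Suc_dup: "p < length w \<Longrightarrow> dup (Suc p) (dup p w) = dup p (dup p w)"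
  by (elim split_at_nth) (auto simp: dup_def)

lemma dup_eq_dup_Suc:
  assumes "dup p w = dup (Suc p) w" "Suc p < length w"
  shows "del p w = del (Suc p) w"
proof -
  obtain u x y v where w: "w = u @ x # y # v" "length u = p"
    using split_at_nth2[OF assms(2)] by blast
  then have "dup p w = u @ x # x # y # v" "dup (Suc p) w = u @ x # y # y # v"
    by (auto simp: dup_def)
  then show ?thesis using assms(1) w by (auto simp: del_append_Suc)
qed

lemma del_surj: "p \<le> length w \<Longrightarrow> \<exists>w'. length w' = Suc (length w) \<and> del p w' = w"
  by (intro exI[of _ "take p w @ undefined # drop p w"]) (auto simp: del_def)

text \<open>The caps. From \<open>m\<close> letters, \<open>ins_rel p m\<close> inserts an arbitrary letter at position \<open>p\<close>,
  \<open>dup_rel p m\<close> doubles the letter at position \<open>p\<close>, and \<open>pair_rel p m\<close> inserts two equal letters. As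
  partitions, they have respectively a lower singleton block, a block joining two neighbouring lower
  vertices to an upper one, and a block of two neighbouring lower vertices; all other blocks join
  one upper to one lower vertex.\<close>

definition ins_rel :: "nat \<Rightarrow> nat \<Rightarrow> bool list rel" where
  "ins_rel p m = {(del p g, g) | g. length g = Suc m}"

definition dup_rel :: "nat \<Rightarrow> nat \<Rightarrow> bool list rel" where
  "dup_rel p m = {(f, dup p f) | f. length f = m}"

definition pair_rel :: "nat \<Rightarrow> nat \<Rightarrow> bool list rel" where
  "pair_rel p m = ins_rel p m O dup_rel p (Suc m)"

definition id_rel :: "nat \<Rightarrow> bool list rel" where
  "id_rel m = {(f, f) | f. length f = m}"

lemma ins_rel_iff: "(f, g) \<in> ins_rel p m \<longleftrightarrow> length g = Suc m \<and> f = del p g"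
  by (auto simp: ins_rel_def)

lemma dup_rel_iff: "(f, g) \<in> dup_rel p m \<longleftrightarrow> length f = m \<and> g = dup p f"
  by (auto simp: dup_rel_def)

lemma id_rel_iff: "(f, g) \<in> id_rel m \<longleftrightarrow> length f = m \<and> g = f"
  by (auto simp: id_rel_def)

lemma rel_iff: "(f, g) \<in> rel fs gs \<longleftrightarrow> (\<exists>h. f = map h fs \<and> g = map h gs)"
  by (auto simp: rel_def)

lemma ins_ins:
  assumes "p \<le> m" shows "ins_rel p m O (ins_rel p m)\<inverse> = id_rel m"
proof (intro equalityI subrelI)
  fix f f' assume "(f, f') \<in> ins_rel p m O (ins_rel p m)\<inverse>"
  then show "(f, f') \<in> id_rel m"
    using assms by (auto simp: ins_rel_iff id_rel_iff length_del)
next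
  fix f f' assume "(f, f') \<in> id_rel m"
  then have "length f = m" "f' = f" by (simp_all add: id_rel_iff)
  then obtain g where "length g = Suc m" "del p g = f" using del_surj[of p f] assms by auto
  then have "(f, g) \<in> ins_rel p m" by (simp add: ins_rel_iff)
  then show "(f, f') \<in> ins_rel p m O (ins_rel p m)\<inverse>" using \<open>f' = f\<close> by blast
qed

lemma dup_dup:
  assumes "p < m" shows "dup_rel p m O (dup_rel p m)\<inverse> = id_rel m"
proof (intro equalityI subrelI)
  fix f f' assume "(f, f') \<in> dup_rel p m O (dup_rel p m)\<inverse>"
  then have "length f = m" "length f' = m" "dup p f = dup p f'"
    unfolding relcomp_unfold mem_Collect_eq case_prod_conv converse_iff dup_rel_iff by metis+
  then show "(f, f') \<in> id_rel m"
    unfolding id_rel_iff using assms del_dup by metis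
next
  fix f f' assume "(f, f') \<in> id_rel m"
  then have "(f, dup p f) \<in> dup_rel p m" "f' = f" by (simp_all add: id_rel_iff dup_rel_iff)
  then show "(f, f') \<in> dup_rel p m O (dup_rel p m)\<inverse>" by blast
qed

lemma ins_dup: "p < m \<Longrightarrow> ins_rel p m O (dup_rel p m)\<inverse> = id_rel m"
  by (auto simp: ins_rel_def dup_rel_def id_rel_def relcomp_unfold del_dup length_dup)

lemma dup_ins: "p < m \<Longrightarrow> dup_rel p m O (ins_rel (Suc p) m)\<inverse> = id_rel m"
  by (auto simp: ins_rel_def dup_rel_def id_rel_def relcomp_unfold del_Suc_dup length_dup)

lemma rel_id_left: "R = rel fs gs \<Longrightarrow> length fs = m \<Longrightarrow> id_rel m O R = R"
  by (auto simp: id_rel_def rel_def relcomp_unfold)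

lemma pair_pair: "p \<le> m \<Longrightarrow> pair_rel p m O (pair_rel p m)\<inverse> = id_rel m"
proof -
  assume p: "p \<le> m"
  have "pair_rel p m O (pair_rel p m)\<inverse>
      = ins_rel p m O (dup_rel p (Suc m) O (dup_rel p (Suc m))\<inverse>) O (ins_rel p m)\<inverse>"
    by (simp add: pair_rel_def converse_relcomp O_assoc)
  also have "\<dots> = ins_rel p m O (ins_rel p m)\<inverse>"
    using p by (auto simp: dup_dup) (auto simp: id_rel_def ins_rel_def relcomp_unfold)
  finally show ?thesis using p by (simp add: ins_ins)
qed

lemma pair_pair_Suc:
  assumes p: "p < m" shows "pair_rel p m O (pair_rel (Suc p) m)\<inverse> = id_rel m"
proof (intro equalityI subrelI)
  \<comment> \<open>An intermediate word has three equal letters at \<open>p\<close>, \<open>p + 1\<close>, \<open>p + 2\<close>.\<close>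
  fix f f' assume "(f, f') \<in> pair_rel p m O (pair_rel (Suc p) m)\<inverse>"
  then obtain g g' where g: "length g = Suc m" "length g' = Suc m" "dup p g = dup (Suc p) g'"
      "f = del p g" "f' = del (Suc p) g'"
    by (auto simp: pair_rel_def ins_rel_def dup_rel_def)
  then have "g = g'" using del_Suc_dup[of p g] del_dup[of "Suc p" g'] p by simp
  then have "f = f'"
    using dup_eq_dup_Suc[of p g'] g p by simp
  with g p show "(f, f') \<in> id_rel m" by (simp add: id_rel_def length_del)
next
  fix f f' assume "(f, f') \<in> id_rel m"
  then have f: "f' = f" "length f = m" by (auto simp: id_rel_def)
  then have "(f, dup p f) \<in> ins_rel p m" "(f, dup p f) \<in> ins_rel (Suc p) m"
    using p unfolding ins_rel_def by (auto intro!: exI[of _ "dup p f"] simp: del_dup del_Suc_dup length_dup)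
  moreover have "(dup p f, dup p (dup p f)) \<in> dup_rel p (Suc m)"
      "(dup p f, dup p (dup p f)) \<in> dup_rel (Suc p) (Suc m)"
    using p f by (auto simp: dup_rel_def length_dup dup_Suc_dup)
  ultimately show "(f, f') \<in> pair_rel p m O (pair_rel (Suc p) m)\<inverse>"
    using f unfolding pair_rel_def by blast
qed

lemma ins_comp:
  assumes "length fs = Suc m" shows "ins_rel p m O rel fs gs = rel (del p fs) gs"
proof (intro equalityI subrelI)
  fix f g assume "(f, g) \<in> ins_rel p m O rel fs gs"
  then show "(f, g) \<in> rel (del p fs) gs"
    unfolding relcomp_unfold mem_Collect_eq case_prod_conv ins_rel_iff rel_iff
    by (metis del_map)
next
  fix f g assume "(f, g) \<in> rel (del p fs) gs"
  then obtain h where "f = map h (del p fs)" "g = map h gs" unfolding rel_iff by blast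
  then have "(f, map h fs) \<in> ins_rel p m" "(map h fs, g) \<in> rel fs gs"
    using assms by (auto simp: ins_rel_iff rel_def del_map)
  then show "(f, g) \<in> ins_rel p m O rel fs gs" by blast
qed

lemma dup_conv_comp:
  assumes "length fs = m" shows "(dup_rel p m)\<inverse> O rel fs gs = rel (dup p fs) gs"
proof (intro equalityI subrelI)
  fix f g assume "(f, g) \<in> (dup_rel p m)\<inverse> O rel fs gs"
  then show "(f, g) \<in> rel (dup p fs) gs"
    unfolding relcomp_unfold mem_Collect_eq case_prod_conv converse_iff dup_rel_iff rel_iff
    by (metis dup_map)
next
  fix f g assume "(f, g) \<in> rel (dup p fs) gs"
  then obtain h where "f = map h (dup p fs)" "g = map h gs" unfolding rel_iff by blast
  then have "(map h fs, f) \<in> dup_rel p m" "(map h fs, g) \<in> rel fs gs"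
    using assms by (auto simp: dup_rel_iff rel_def dup_map)
  then show "(f, g) \<in> (dup_rel p m)\<inverse> O rel fs gs" by blast
qed

lemma ins_conv_comp:
  assumes "z \<notin> set (u @ v @ gs)" "m = length (u @ v)"
  shows "(ins_rel (length u) m)\<inverse> O rel (u @ v) gs = rel (u @ z # v) gs"
proof (intro equalityI subrelI)
  fix f g assume "(f, g) \<in> (ins_rel (length u) m)\<inverse> O rel (u @ v) gs"
  then obtain h where h: "length f = Suc m" "del (length u) f = map h (u @ v)" "g = map h gs"
    unfolding relcomp_unfold mem_Collect_eq case_prod_conv converse_iff ins_rel_iff rel_iff
    by metis
  with assms(2) obtain u' x v' where f: "f = u' @ x # v'" "length u' = length u"
    using split_at_nth[of "length u" f] by auto
  have "u' @ v' = map h u @ map h v"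
    using h(2) f del_append[of u' x v'] by simp
  then have "u' = map h u" "v' = map h v"
    using f(2) by simp_all
  then have "f = map (h(z := x)) (u @ z # v)" "g = map (h(z := x)) gs"
    using f h assms by auto
  then show "(f, g) \<in> rel (u @ z # v) gs" unfolding rel_def by blast
next
  fix f g assume "(f, g) \<in> rel (u @ z # v) gs"
  then obtain h where h: "f = map h (u @ z # v)" "g = map h gs" by (auto simp: rel_def)
  have "(map h (u @ z # v), map h (u @ v)) \<in> (ins_rel (length u) m)\<inverse>"
    using assms(2) unfolding ins_rel_def
    by (auto intro!: exI[of _ "map h (u @ z # v)"] simp: del_map simp del: map_append list.map(2))
  then show "(f, g) \<in> (ins_rel (length u) m)\<inverse> O rel (u @ v) gs"
    using h by (auto simp: rel_def simp del: map_append)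
qed

lemma dup_comp:
  assumes "m = Suc (length (u @ v))"
  shows "dup_rel (length u) m O rel (u @ x # y # v) gs
   = rel (map (identify x y) (u @ x # v)) (map (identify x y) gs)"
proof (intro equalityI subrelI)
  fix f g assume "(f, g) \<in> dup_rel (length u) m O rel (u @ x # y # v) gs"
  then obtain h where h: "length f = m" "dup (length u) f = map h (u @ x # y # v)" "g = map h gs"
    unfolding relcomp_unfold mem_Collect_eq case_prod_conv dup_rel_iff rel_iff
    by metis
  with assms obtain u' z v' where f: "f = u' @ z # v'" "length u' = length u"
    using split_at_nth[of "length u" f] by auto
  have "u' @ z # z # v' = map h u @ h x # h y # map h v"
    using h(2) f dup_append[of u' z v'] by simp
  then have "u' = map h u" "v' = map h v" "z = h x" "z = h y"
    using f(2) by auto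
  moreover from this have "h \<circ> identify x y = h" by (simp add: fun_eq_iff identify_def)
  ultimately have "f = map h (map (identify x y) (u @ x # v))" "g = map h (map (identify x y) gs)"
    unfolding map_map f(1) h(3) by simp_all
  then show "(f, g) \<in> rel (map (identify x y) (u @ x # v)) (map (identify x y) gs)"
    unfolding rel_def by blast
next
  let ?s = "identify x y"
  fix f g assume "(f, g) \<in> rel (map ?s (u @ x # v)) (map ?s gs)"
  then obtain h where h: "f = map h (map ?s (u @ x # v))" "g = map h (map ?s gs)"
    unfolding rel_def by blast
  have "(f, map (h \<circ> ?s) (u @ x # y # v)) \<in> dup_rel (length u) m"
    unfolding dup_rel_def using assms h(1) by (auto simp: dup_map simp del: map_append list.map(2)) simp
  moreover have "(map (h \<circ> ?s) (u @ x # y # v), g) \<in> rel (u @ x # y # v) gs"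
    unfolding rel_iff h(2) map_map by (intro exI[of _ "h \<circ> ?s"] conjI refl)
  ultimately show "(f, g) \<in> dup_rel (length u) m O rel (u @ x # y # v) gs" by blast
qed

section \<open>Reduction of noncrossing partitions\<close>

lemma rel_distinct:
  assumes "distinct fs" shows "rel fs fs = id_rel (length fs)"
proof (intro equalityI subrelI)
  fix f g assume "(f, g) \<in> id_rel (length fs)"
  then have f: "length f = length fs" "g = f" by (simp_all add: id_rel_iff)
  define h where "h z = (case map_of (zip fs f) z of Some b \<Rightarrow> b | None \<Rightarrow> False)" for z
  have "f = map h fs"
    using f(1) assms by (intro nth_equalityI) (simp_all add: h_def map_of_zip_nth)
  then show "(f, g) \<in> rel fs fs" using f(2) unfolding rel_iff by blast
qed (auto simp: rel_iff id_rel_iff)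

text \<open>Two neighbouring vertices on the side of \<open>fs\<close> lie in the same block, or some vertex of that side is
  a singleton block.\<close>

definition reducible :: "'c list \<Rightarrow> 'c list \<Rightarrow> bool" where
  "reducible fs gs \<longleftrightarrow> (\<exists>u x v. fs = u @ x # x # v) \<or> (\<exists>u x v. fs = u @ x # v \<and> x \<notin> set (u @ v @ gs))"

lemma reducible_adjacent: "Suc p < length fs \<Longrightarrow> fs ! p = fs ! Suc p \<Longrightarrow> reducible fs gs"
  by (erule split_at_nth2) (auto simp: reducible_def nth_append)

lemma reducible_singleton:
  assumes "p < length fs" "\<And>q. q < length fs \<Longrightarrow> q \<noteq> p \<Longrightarrow> fs ! q \<noteq> fs ! p" "fs ! p \<notin> set gs"
  shows "reducible fs gs"
proof -
  have "fs = take p fs @ fs ! p # drop (Suc p) fs" using assms(1) by (rule id_take_nth_drop)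
  moreover have "fs ! p \<notin> set (take p fs)"
    using assms(2) by (force simp: in_set_conv_nth)
  moreover have "fs ! p \<notin> set (drop (Suc p) fs)"
    using assms(1,2) by (force simp: in_set_conv_nth)
  ultimately show ?thesis
    using assms(3) unfolding reducible_def by fastforce
qed

text \<open>A noncrossing word without singleton blocks in which equal neighbours occur at most at the
  positions \<open>n - 1\<close> and \<open>n\<close> is a palindrome with centre between these positions. Two equally
  coloured positions on one side of the centre would enclose a closer pair of the same kind. Hence all
  blocks cross the centre, and they are nested.\<close>

context
  fixes w :: "'c list" and n :: nat
  assumes nc: "noncrossing w" and n_le: "n \<le> length w"
    and step: "\<And>p. Suc p < length w \<Longrightarrow> Suc p \<noteq> n \<Longrightarrow> w ! p \<noteq> w ! Suc p"
    and partner: "\<And>p. p < length w \<Longrightarrow> \<exists>q < length w. q \<noteq> p \<and> w ! q = w ! p"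
begin

lemma irreducible_across:
  "i < j \<Longrightarrow> j < length w \<Longrightarrow> w ! i = w ! j \<Longrightarrow> i < n \<and> n \<le> j"
proof (induction "j - i" arbitrary: i j rule: less_induct)
  case less
  note IH = less.hyps and prems = less.prems
  show ?case
  proof (rule ccontr)
    assume side: "\<not> (i < n \<and> n \<le> j)"
    then have "j \<noteq> Suc i" using step[of i] prems by auto
    then have ij: "Suc i < j" using prems by simp
    then have ne: "w ! Suc i \<noteq> w ! i" using step[of i] side prems by auto
    obtain q where q: "q < length w" "q \<noteq> Suc i" "w ! q = w ! Suc i"
      using partner[of "Suc i"] ij prems by auto
    have "q \<noteq> i" "q \<noteq> j" using q ne prems by auto
    moreover have "\<not> q < i"
      using noncrossingD[OF nc, of q i "Suc i" j] q ne ij prems by auto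
    moreover have "\<not> j < q"
      using noncrossingD[OF nc, of i "Suc i" j q] q ne ij prems by auto
    ultimately have "Suc i < q" "q < j" using q(2) by linarith+
    moreover from this have "q - Suc i < j - i" by arith
    ultimately show False using IH[of q "Suc i"] q side by auto
  qed
qed

lemma irreducible_nested:
  "i < j \<Longrightarrow> j < length w \<Longrightarrow> w ! i = w ! j \<Longrightarrow> Suc (i + j) = 2 * n"
proof (induction "j - i" arbitrary: i j rule: less_induct)
  case less
  note IH = less.hyps and prems = less.prems
  note across = irreducible_across
  have ij: "i < n" "n \<le> j" using across[of i j] prems by auto
  show ?case
  proof (cases "j = Suc i")
    case True
    then show ?thesis using ij by simp
  next
    case False
    then have lt: "Suc i < j" using prems by simp
    have i: "Suc i < n"
    proof (rule ccontr)
      assume "\<not> Suc i < n"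
      then have n: "n = Suc i" using ij by simp
      obtain t where t: "t < length w" "t \<noteq> n" "w ! t = w ! n"
        using partner[of n] n lt prems by auto
      have nj: "w ! n \<noteq> w ! j" using across[of n j] n lt prems by auto
      have "\<not> n < t" using across[of n t] t by auto
      then have "t < n" using t(2) by simp
      then have "t < i" using n t nj prems by (metis less_antisym)
      then show False using noncrossingD[OF nc, of t i n j] t nj lt n prems by auto
    qed
    obtain q where q: "q < length w" "q \<noteq> Suc i" "w ! q = w ! Suc i"
      using partner[of "Suc i"] lt prems by auto
    have "\<not> q < Suc i" using across[of q "Suc i"] q i lt prems by auto
    then have "Suc i < q" using q by simp
    then have nq: "n \<le> q" using across[of "Suc i" q] q by auto
    have ne: "w ! Suc i \<noteq> w ! i" using across[of i "Suc i"] i lt prems by auto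
    then have "q \<noteq> j" using q prems by auto
    moreover have "\<not> j < q"
      using noncrossingD[OF nc, of i "Suc i" j q] q ne lt prems by auto
    ultimately have qj: "q < j" by simp
    have sum: "Suc (Suc i + q) = 2 * n"
      using IH[of q "Suc i"] q qj \<open>Suc i < q\<close> by auto
    have "Suc q = j"
    proof (rule ccontr)
      assume "Suc q \<noteq> j"
      then have qj: "Suc q < j" using qj by simp
      obtain t where t: "t < length w" "t \<noteq> Suc q" "w ! t = w ! Suc q"
        using partner[of "Suc q"] qj prems by auto
      have "\<not> Suc q < t" using across[of "Suc q" t] t nq by auto
      then have "t < Suc q" using t(2) by simp
      then have tn: "t < n" using across[of t "Suc q"] t qj prems by auto
      have ne1: "w ! Suc q \<noteq> w ! q" using across[of q "Suc q"] qj nq prems by auto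
      have ne2: "w ! Suc q \<noteq> w ! j" using across[of "Suc q" j] qj nq prems by auto
      have "t \<noteq> i" "t \<noteq> Suc i" using t ne1 ne2 q prems by auto
      then consider "t < i" | "Suc i < t" by linarith
      then show False
      proof cases
        case 1
        then show ?thesis
          using noncrossingD[OF nc, of t i "Suc q" j] t ne2 qj ij nq prems by auto
      next
        case 2
        then show ?thesis
          using noncrossingD[OF nc, of "Suc i" t q "Suc q"] t ne1 q tn nq qj prems by auto
      qed
    qed
    then show ?thesis using sum by simp
  qed
qed

lemma irreducible_palindrome:
  "length w = 2 * n" "\<And>i. i < n \<Longrightarrow> w ! i = w ! (2 * n - Suc i)" "inj_on ((!) w) {..<n}"
proof -
  have partner': "\<exists>q<length w. Suc (p + q) = 2 * n \<and> w ! q = w ! p" if p: "p < length w" for p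
  proof -
    obtain q where q: "q < length w" "q \<noteq> p" "w ! q = w ! p" using partner[OF p] by blast
    then show ?thesis
      using irreducible_nested[of p q] irreducible_nested[of q p] p
      by (metis add.commute linorder_neqE_nat)
  qed
  show len: "length w = 2 * n"
  proof (cases "length w = 0")
    case True
    then show ?thesis using n_le by simp
  next
    case False
    then show ?thesis using partner'[of 0] partner'[of "length w - 1"] by auto
  qed
  show "w ! i = w ! (2 * n - Suc i)" if "i < n" for i
  proof -
    have "i < length w" using that len by simp
    from partner'[OF this] obtain q where "Suc (i + q) = 2 * n" "w ! q = w ! i" by blast
    moreover from this have "q = 2 * n - Suc i" by simp
    ultimately show ?thesis by simp
  qed
  show "inj_on ((!) w) {..<n}"
  proof (rule linorder_inj_onI)
    fix i j assume "i < j" "i \<in> {..<n}" "j \<in> {..<n}"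
    then show "w ! i \<noteq> w ! j" using irreducible_across[of i j] len by auto
  qed auto
qed

end

text \<open>The lower vertices from left to right, followed by the upper vertices from right to left, run
  along the boundary of the rectangle. A noncrossing partition that is irreducible on both sides
  is an identity.\<close>

lemma irreducible_identity:
  assumes nc: "noncrossing (gs @ rev fs)" and "\<not> reducible fs gs" "\<not> reducible gs fs"
  shows "fs = gs \<and> distinct fs"
proof -
  let ?w = "gs @ rev fs" and ?n = "length gs"
  have step: "?w ! p \<noteq> ?w ! Suc p" if "Suc p < length ?w" "Suc p \<noteq> ?n" for p
  proof (cases "Suc p < ?n")
    case True
    then have "?w ! p = gs ! p" "?w ! Suc p = gs ! Suc p" by (auto simp: nth_append)
    then show ?thesis using reducible_adjacent[OF True] assms(3) by metis
  next
    case False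
    define q where "q = length ?w - Suc (Suc p)"
    have q: "Suc q < length fs" "?w ! p = fs ! Suc q" "?w ! Suc p = fs ! q"
      using that False by (auto simp: q_def nth_append rev_nth Suc_diff_Suc add.commute)
    then show ?thesis using reducible_adjacent[of q fs gs] assms(2) by metis
  qed
  have partner: "\<exists>q < length ?w. q \<noteq> p \<and> ?w ! q = ?w ! p" if "p < length ?w" for p
  proof (rule ccontr)
    assume *: "\<not> ?thesis"
    show False
    proof (cases "p < ?n")
      case True
      have "gs ! q \<noteq> gs ! p" if "q < ?n" "q \<noteq> p" for q
        using *[simplified] that True by (auto simp: nth_append dest: spec[of _ q])
      moreover have "gs ! p \<notin> set fs"
      proof
        assume "gs ! p \<in> set fs"
        then obtain k where "k < length (rev fs)" "rev fs ! k = gs ! p"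
          by (metis in_set_conv_nth set_rev)
        then show False using * True by (auto simp: nth_append dest: spec[of _ "?n + k"])
      qed
      ultimately show False using reducible_singleton[OF True] assms(3) by blast
    next
      case False
      define k where "k = length ?w - Suc p"
      have k: "k < length fs" "?w ! p = fs ! k" "p = length ?w - Suc k"
        using that False by (auto simp: k_def nth_append rev_nth add.commute)
      have "fs ! q \<noteq> fs ! k" if "q < length fs" "q \<noteq> k" for q
      proof -
        have "?w ! (length ?w - Suc q) = fs ! q" using that by (auto simp: nth_append rev_nth)
        moreover have "length ?w - Suc q \<noteq> p" "length ?w - Suc q < length ?w"
          using that k by auto
        ultimately show ?thesis using * k by metis
      qed
      moreover have "fs ! k \<notin> set gs"
      proof
        assume "fs ! k \<in> set gs"
        then obtain q where "q < ?n" "gs ! q = fs ! k" by (metis in_set_conv_nth)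
        then have "q < length ?w" "q \<noteq> p" "?w ! q = ?w ! p" using k False by (auto simp: nth_append)
        then show False using * by blast
      qed
      ultimately show False using reducible_singleton[OF k(1)] assms(2) by blast
    qed
  qed
  have le: "?n \<le> length ?w" by simp
  have pal: "length ?w = 2 * ?n" "\<And>i. i < ?n \<Longrightarrow> ?w ! i = ?w ! (2 * ?n - Suc i)"
      "inj_on ((!) ?w) {..<?n}"
    by (rule irreducible_palindrome[OF nc le]; use step partner in blast)+
  have len: "length fs = ?n" using pal(1) by simp
  have "gs ! i = fs ! i" if "i < ?n" for i
    using pal(2)[OF that] that len by (auto simp: nth_append rev_nth)
  then have "fs = gs" using len by (intro nth_equalityI) auto
  moreover have "inj_on ((!) gs) {..<?n}"
    using pal(3) by (auto simp: inj_on_def nth_append)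
  ultimately show ?thesis by (auto simp: distinct_conv_nth inj_on_def)
qed

section \<open>Hom-sets of relations\<close>

text \<open>The boundary word \<open>gs @ rev fs\<close> lists the colours of the lower vertices from left to right and then
  those of the upper vertices from right to left.\<close>

definition planar_rels :: "nat \<Rightarrow> nat \<Rightarrow> bool list rel set" where
  "planar_rels m n = {rel fs gs | fs gs. length fs = m \<and> length gs = n \<and> noncrossing (gs @ rev fs)}"

text \<open>All blocks have size 2.\<close>

definition paired :: "'c list \<Rightarrow> bool" where
  "paired w \<longleftrightarrow> (\<forall>z\<in>set w. count_list w z = 2)"

definition TL_rels :: "nat \<Rightarrow> nat \<Rightarrow> bool list rel set" where
  "TL_rels m n = {rel fs gs | fs gs. length fs = m \<and> length gs = n \<and> noncrossing (gs @ rev fs)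
     \<and> paired (gs @ rev fs)}"

lemma planar_relsI: "noncrossing (gs @ rev fs) \<Longrightarrow> length fs = m \<Longrightarrow> length gs = n \<Longrightarrow>
    rel fs gs \<in> planar_rels m n"
  unfolding planar_rels_def by blast

lemma planar_relsE:
  assumes "R \<in> planar_rels m n"
  obtains fs gs where "R = rel fs gs" "length fs = m" "length gs = n" "noncrossing (gs @ rev fs)"
  using assms unfolding planar_rels_def by blast

lemma TL_relsI: "noncrossing (gs @ rev fs) \<Longrightarrow> paired (gs @ rev fs) \<Longrightarrow> length fs = m \<Longrightarrow>
    length gs = n \<Longrightarrow> rel fs gs \<in> TL_rels m n"
  unfolding TL_rels_def by blast

lemma TL_relsE:
  assumes "R \<in> TL_rels m n"
  obtains fs gs where "R = rel fs gs" "length fs = m" "length gs = n" "noncrossing (gs @ rev fs)"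
    "paired (gs @ rev fs)"
  using assms unfolding TL_rels_def by blast

lemma noncrossing_swap: "noncrossing (gs @ rev fs) \<Longrightarrow> noncrossing (fs @ rev gs)"
  using noncrossing_rev[of "gs @ rev fs"] by simp

lemma fresh_colour: "\<exists>z::nat. z \<notin> set w"
  by (rule ex_new_if_finite) auto

lemma noncrossing_distinct: "distinct w \<Longrightarrow> noncrossing (w @ rev w)"
proof -
  assume d: "distinct w"
  let ?v = "w @ rev w" and ?n = "length w"
  have eq: "i = j \<or> Suc (i + j) = 2 * ?n" if "?v ! i = ?v ! j" "i < 2 * ?n" "j < 2 * ?n" for i j
    using that d by (auto simp: nth_append rev_nth nth_eq_iff_index_eq split: if_splits)
  show ?thesis
    unfolding noncrossing_def
  proof (intro allI impI)
    fix a b c e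
    assume "a < b" "b < c" "c < e" "e < length ?v" "?v ! a = ?v ! c" "?v ! b = ?v ! e"
    then show "?v ! a = ?v ! b" using eq[of a c] eq[of b e] by auto
  qed
qed

lemma id_planar: "id_rel m \<in> planar_rels m m"
  using rel_distinct[of "[0..<m]"] noncrossing_distinct[of "[0..<m]"]
  unfolding planar_rels_def by force

lemma paired_distinct: "distinct w \<Longrightarrow> paired (w @ rev w)"
proof -
  have "count_list w z = 1" if "distinct w" "z \<in> set w" for z
    using that by (induction w) auto
  then show "paired (w @ rev w)" if "distinct w"
    using that by (auto simp: paired_def)
qed

lemma id_TL: "id_rel m \<in> TL_rels m m"
  using rel_distinct[of "[0..<m]"] noncrossing_distinct[of "[0..<m]"] paired_distinct[of "[0..<m]"]
  unfolding TL_rels_def by force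

lemma planar_conv: "R \<in> planar_rels m n \<Longrightarrow> R\<inverse> \<in> planar_rels n m"
  by (elim planar_relsE) (auto simp: rel_converse intro: planar_relsI noncrossing_swap)

lemma paired_swap: "paired (gs @ rev fs) \<Longrightarrow> paired (fs @ rev gs)"
  unfolding paired_def by (simp add: count_list_append Un_commute add.commute)

lemma TL_conv: "R \<in> TL_rels m n \<Longrightarrow> R\<inverse> \<in> TL_rels n m"
  by (elim TL_relsE) (auto simp: rel_converse intro: TL_relsI noncrossing_swap paired_swap)

lemma id_left_planar: "R \<in> planar_rels m n \<Longrightarrow> id_rel m O R = R"
  by (elim planar_relsE) (auto simp: rel_id_left)

lemma id_left_TL: "R \<in> TL_rels m n \<Longrightarrow> id_rel m O R = R"
  by (elim TL_relsE) (auto simp: rel_id_left)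

lemma ins_comp_planar:
  assumes "p \<le> m" "R \<in> planar_rels (Suc m) n" shows "ins_rel p m O R \<in> planar_rels m n"
proof -
  from assms(2) obtain fs gs where R: "R = rel fs gs" "length fs = Suc m" "length gs = n"
    "noncrossing (gs @ rev fs)" by (rule planar_relsE)
  moreover from this assms obtain u x v where f: "fs = u @ x # v" "length u = p"
    using split_at_nth[of p fs] by auto
  ultimately have "noncrossing (gs @ rev (u @ v))"
    using noncrossing_delete[of "gs @ rev v" x "rev u"] by simp
  then show ?thesis
    using R f by (auto simp: ins_comp intro: planar_relsI)
qed

lemma ins_conv_comp_planar:
  assumes "p \<le> m" "R \<in> planar_rels m n" shows "(ins_rel p m)\<inverse> O R \<in> planar_rels (Suc m) n"
proof -
  from assms(2) obtain fs gs where R: "R = rel fs gs" "length fs = m" "length gs = n"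
    "noncrossing (gs @ rev fs)" by (rule planar_relsE)
  define u v where "u = take p fs" and "v = drop p fs"
  then have f: "fs = u @ v" "length u = p" using R assms by auto
  obtain z where z: "z \<notin> set (u @ v @ gs)" using fresh_colour by blast
  have "noncrossing (gs @ rev (u @ z # v))"
    using noncrossing_insert[of "gs @ rev v" "rev u" z] R z f by simp
  moreover have "(ins_rel p m)\<inverse> O R = rel (u @ z # v) gs"
    using ins_conv_comp[OF z, of m] R f by simp
  ultimately show ?thesis
    using R f by (auto intro: planar_relsI)
qed

lemma noncrossing_identify_source:
  assumes "noncrossing (gs @ rev (u @ x # y # v))"
  shows "noncrossing (map (identify x y) gs @ rev (map (identify x y) (u @ x # v)))"
proof -
  let ?s = "identify x y"
  have "noncrossing (u @ [x, y] @ v @ rev gs)" using noncrossing_swap[OF assms] by simp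
  then have "noncrossing (map ?s u @ [x] @ [x] @ map ?s (v @ rev gs))"
    using noncrossing_identify[of u x y "v @ rev gs"] by simp
  then have "noncrossing (map ?s (u @ x # v) @ rev (map ?s gs))"
    using noncrossing_delete[of "map ?s u" x "[x] @ map ?s (v @ rev gs)"] by (simp add: rev_map)
  then show ?thesis by (rule noncrossing_swap)
qed

lemma dup_comp_planar:
  assumes "p < m" "R \<in> planar_rels (Suc m) n" shows "dup_rel p m O R \<in> planar_rels m n"
proof -
  from assms(2) obtain fs gs where R: "R = rel fs gs" "length fs = Suc m" "length gs = n"
    "noncrossing (gs @ rev fs)" by (rule planar_relsE)
  have "Suc p < length fs" using R assms by simp
  then obtain u x y v where f: "fs = u @ x # y # v" "length u = p"
    using split_at_nth2 by blast
  then show ?thesis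
    using R dup_comp[of m u v x y gs] noncrossing_identify_source[of gs u x y v]
    by (auto intro!: planar_relsI simp del: map_append list.map(2))
qed

lemma dup_conv_comp_planar:
  assumes "p < m" "R \<in> planar_rels m n" shows "(dup_rel p m)\<inverse> O R \<in> planar_rels (Suc m) n"
proof -
  from assms(2) obtain fs gs where R: "R = rel fs gs" "length fs = m" "length gs = n"
    "noncrossing (gs @ rev fs)" by (rule planar_relsE)
  moreover from this assms obtain u x v where f: "fs = u @ x # v" "length u = p"
    using split_at_nth[of p fs] by auto
  ultimately have "noncrossing (gs @ rev (u @ x # x # v))"
    using noncrossing_duplicate[of "gs @ rev v" x "rev u"] by simp
  then show ?thesis
    using R f by (auto simp: dup_conv_comp intro: planar_relsI)
qed

lemma pair_conv_comp:
  assumes "z \<notin> set (u @ v @ gs)" "m = length (u @ v)"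
  shows "(pair_rel (length u) m)\<inverse> O rel (u @ v) gs = rel (u @ z # z # v) gs"
  using ins_conv_comp[OF assms] assms(2)
  by (simp add: pair_rel_def converse_relcomp O_assoc dup_conv_comp)

lemma pair_comp:
  assumes "m = length (u @ v)"
  shows "pair_rel (length u) m O rel (u @ x # y # v) gs
    = rel (map (identify x y) (u @ v)) (map (identify x y) gs)"
proof -
  have "del (length u) (map (identify x y) (u @ x # v)) = map (identify x y) (u @ v)"
    by (simp only: del_map del_append)
  then show ?thesis
    using assms dup_comp[of "Suc m" u v x y gs] ins_comp[of "map (identify x y) (u @ x # v)" m]
    by (simp add: pair_rel_def O_assoc del: map_append list.map(2))
qed

lemma count_list_identify: "count_list (map (identify x y) w) z =
    (if z = x then count_list w x + (if y = x then 0 else count_list w y)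
     else if z = y then 0 else count_list w z)"
  by (induction w) (auto simp: identify_def)

lemma paired_cap:
  assumes "paired (a @ x # y # b)" shows "paired (map (identify x y) (a @ b))"
  unfolding paired_def
proof
  fix z assume "z \<in> set (map (identify x y) (a @ b))"
  then have z: "z = x \<and> (x \<in> set (a @ b) \<or> y \<in> set (a @ b)) \<or> z \<noteq> x \<and> z \<noteq> y \<and> z \<in> set (a @ b)"
    unfolding set_map identify_def image_iff by metis
  have c: "count_list (a @ x # y # b) x = 2" "count_list (a @ x # y # b) y = 2"
      "z \<in> set (a @ b) \<Longrightarrow> count_list (a @ x # y # b) z = 2"
    using assms unfolding paired_def by simp_all
  show "count_list (map (identify x y) (a @ b)) z = 2"
  proof (cases "x = y")
    case True
    then have "count_list a x = 0" "count_list b x = 0" using c(1) by auto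
    then have "x \<notin> set (a @ b)" by (simp add: count_list_0_iff)
    then show ?thesis using c(3) z True by (auto simp: count_list_identify simp del: map_append)
  next
    case False
    then show ?thesis using c z by (auto simp: count_list_identify simp del: map_append)
  qed
qed

lemma paired_insert:
  assumes "paired (a @ b)" "z \<notin> set (a @ b)" shows "paired (a @ z # z # b)"
  using assms by (auto simp: paired_def count_list_0_iff)

lemma pair_comp_TL:
  assumes "p \<le> m" "R \<in> TL_rels (m + 2) n" shows "pair_rel p m O R \<in> TL_rels m n"
proof -
  from assms(2) obtain fs gs where R: "R = rel fs gs" "length fs = m + 2" "length gs = n"
    "noncrossing (gs @ rev fs)" "paired (gs @ rev fs)" by (rule TL_relsE)
  have "Suc p < length fs" using R assms by simp
  then obtain u x y v where f: "fs = u @ x # y # v" "length u = p"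
    using split_at_nth2 by blast
  let ?s = "identify x y"
  have nc: "noncrossing (map ?s gs @ rev (map ?s (u @ v)))"
    using noncrossing_identify_source[of gs u x y v] R f
      noncrossing_delete[of "map ?s gs @ rev (map ?s v)" x "rev (map ?s u)"] by simp
  have "paired (fs @ rev gs)" using R(5) by (rule paired_swap)
  then have "paired (map ?s (u @ v) @ rev (map ?s gs))"
    using paired_cap[of u x y "v @ rev gs"] f by (simp add: rev_map)
  then have "paired (map ?s gs @ rev (map ?s (u @ v)))" by (rule paired_swap)
  with nc show ?thesis
    using R f pair_comp[of m u v x y gs] by (auto intro!: TL_relsI simp del: map_append)
qed

lemma pair_conv_comp_TL:
  assumes "p \<le> m" "R \<in> TL_rels m n" shows "(pair_rel p m)\<inverse> O R \<in> TL_rels (m + 2) n"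
proof -
  from assms(2) obtain fs gs where R: "R = rel fs gs" "length fs = m" "length gs = n"
    "noncrossing (gs @ rev fs)" "paired (gs @ rev fs)" by (rule TL_relsE)
  define u v where "u = take p fs" and "v = drop p fs"
  then have f: "fs = u @ v" "length u = p" using R assms by auto
  obtain z where z: "z \<notin> set (u @ v @ gs)" using fresh_colour by blast
  have "noncrossing (gs @ rev (u @ z # z # v))"
    using noncrossing_duplicate[of "gs @ rev v" z "rev u"]
      noncrossing_insert[of "gs @ rev v" "rev u" z] R z f by simp
  moreover have "paired (fs @ rev gs)" using R(5) by (rule paired_swap)
  then have "paired (u @ z # z # v @ rev gs)"
    using paired_insert[of u "v @ rev gs" z] z f by simp
  then have "paired ((u @ z # z # v) @ rev gs)" by simp
  then have "paired (gs @ rev (u @ z # z # v))" by (rule paired_swap)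
  moreover have "(pair_rel p m)\<inverse> O R = rel (u @ z # z # v) gs"
    using pair_conv_comp[OF z, of m] R f by simp
  ultimately show ?thesis
    using R f by (auto intro: TL_relsI)
qed

text \<open>The chain of caps \<open>ins_rel 0\<close>, \<open>dup_rel 0\<close>, \<open>ins_rel 1\<close>, \<open>dup_rel 1\<close>, ..., \<open>ins_rel m\<close> of the planar
  category.\<close>

definition planar_cap :: "nat \<Rightarrow> nat \<Rightarrow> bool list rel" where
  "planar_cap m i = (if even i then ins_rel (i div 2) m else dup_rel (i div 2) m)"

lemma reducible_planar_cap:
  assumes "reducible fs gs" "length fs = m"
  shows "\<exists>k i. m = k + 1 \<and> i < 2 * k + 1 \<and>
    rel fs gs = (planar_cap k i)\<inverse> O (planar_cap k i O rel fs gs)"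
  using assms(1) unfolding reducible_def
proof (elim disjE exE conjE)
  fix u x v assume f: "fs = u @ x # x # v"
  let ?k = "Suc (length (u @ v))"
  have "dup_rel (length u) ?k O rel fs gs = rel (u @ x # v) gs"
    using dup_comp[of ?k u v x x gs] f by simp
  moreover have "(dup_rel (length u) ?k)\<inverse> O rel (u @ x # v) gs = rel fs gs"
    using dup_conv_comp[of "u @ x # v" ?k "length u" gs] f by simp
  ultimately show ?thesis
    using f assms(2) by (intro exI[of _ ?k] exI[of _ "Suc (2 * length u)"]) (simp add: planar_cap_def)
next
  fix u x v assume f: "fs = u @ x # v" "x \<notin> set (u @ v @ gs)"
  let ?k = "length (u @ v)"
  have "ins_rel (length u) ?k O rel fs gs = rel (u @ v) gs"
    using ins_comp[of fs ?k "length u" gs] f by simp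
  moreover have "(ins_rel (length u) ?k)\<inverse> O rel (u @ v) gs = rel fs gs"
    using ins_conv_comp[OF f(2) refl] f by simp
  ultimately show ?thesis
    using f assms(2) by (intro exI[of _ ?k] exI[of _ "2 * length u"]) (simp add: planar_cap_def)
qed

lemma reducible_pair_rel:
  assumes "reducible fs gs" "length fs = m" "paired (gs @ rev fs)"
  shows "\<exists>k i. m = k + 2 \<and> i < k + 1 \<and>
    rel fs gs = (pair_rel i k)\<inverse> O (pair_rel i k O rel fs gs)"
  using assms(1) unfolding reducible_def
proof (elim disjE exE conjE)
  fix u x v assume f: "fs = u @ x # x # v"
  let ?k = "length (u @ v)"
  have "count_list (gs @ rev fs) x = 2" using assms(3) f by (simp add: paired_def)
  then have x: "x \<notin> set (u @ v @ gs)" by (auto simp: f count_list_0_iff)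
  have "pair_rel (length u) ?k O rel fs gs = rel (u @ v) gs"
    using pair_comp[of ?k u v x x gs] f by simp
  moreover have "(pair_rel (length u) ?k)\<inverse> O rel (u @ v) gs = rel fs gs"
    using pair_conv_comp[OF x refl] f by simp
  ultimately show ?thesis
    using f assms(2) by (intro exI[of _ ?k] exI[of _ "length u"]) simp
next
  fix u x v assume f: "fs = u @ x # v" "x \<notin> set (u @ v @ gs)"
  then have "count_list (gs @ rev fs) x = 1" by simp
  moreover have "count_list (gs @ rev fs) x = 2" using assms(3) f by (simp add: paired_def)
  ultimately show ?thesis by simp
qed

lemma reduce_right:
  assumes "rel gs fs = c\<inverse> O (c O rel gs fs)"
  shows "rel fs gs = (rel fs gs O c\<inverse>) O c"
proof -
  have "(rel gs fs)\<inverse> = (c\<inverse> O (c O rel gs fs))\<inverse>" using assms by (rule arg_cong)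
  then show ?thesis by (simp add: converse_relcomp rel_converse O_assoc)
qed

lemma planar_cap_index:
  "(i::nat) < 2 * m + 1 \<Longrightarrow> if even i then i div 2 \<le> m else i div 2 < m"
  by (auto elim!: oddE)

lemma planar_cap_mem:
  assumes "i < 2 * m + 1" "R \<in> planar_rels (m + 1) n" shows "planar_cap m i O R \<in> planar_rels m n"
  using planar_cap_index[OF assms(1)] assms(2)
  by (auto simp: planar_cap_def intro!: ins_comp_planar dup_comp_planar)

lemma planar_cup_mem:
  assumes "i < 2 * m + 1" "R \<in> planar_rels m n"
  shows "(planar_cap m i)\<inverse> O R \<in> planar_rels (m + 1) n"
  using planar_cap_index[OF assms(1)] assms(2)
  by (auto simp: planar_cap_def intro!: ins_conv_comp_planar dup_conv_comp_planar)

lemma relcomp_id_rel: "(\<And>f g. (f, g) \<in> R \<Longrightarrow> length g = m) \<Longrightarrow> R O id_rel m = R"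
  by (auto simp: id_rel_iff)

lemma planar_cap_id: "i < 2 * m + 1 \<Longrightarrow> planar_cap m i O id_rel (m + 1) = planar_cap m i"
  using planar_cap_index[of i m]
  by (intro relcomp_id_rel) (auto simp: planar_cap_def ins_rel_iff dup_rel_iff length_dup split: if_splits)

lemma pair_rel_id: "i \<le> m \<Longrightarrow> pair_rel i m O id_rel (m + 2) = pair_rel i m"
  by (intro relcomp_id_rel) (auto simp: pair_rel_def dup_rel_iff length_dup)

interpretation planar_chain: cap_chain planar_rels id_rel 1 "\<lambda>m. 2 * m + 1" planar_cap
proof
  fix m n i R
  show "planar_cap m i O (planar_cap m i)\<inverse> = id_rel m" if "i < 2 * m + 1"
    using that planar_cap_index[of i m] by (simp add: planar_cap_def ins_ins dup_dup)
  show "planar_cap m i O (planar_cap m (Suc i))\<inverse> = id_rel m" if "Suc i < 2 * m + 1"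
    using that planar_cap_index[of i m] planar_cap_index[of "Suc i" m]
    by (simp add: planar_cap_def ins_dup dup_ins)
  show "planar_cap m i \<in> planar_rels m (m + 1)" if "i < 2 * m + 1"
    using planar_cap_mem[OF that id_planar] planar_cap_id[OF that] by simp
  show "m = n \<and> R = id_rel m
      \<or> (\<exists>k i. m = k + 1 \<and> i < 2 * k + 1 \<and> R = (planar_cap k i)\<inverse> O (planar_cap k i O R))
      \<or> (\<exists>k i. n = k + 1 \<and> i < 2 * k + 1 \<and> R = (R O (planar_cap k i)\<inverse>) O planar_cap k i)"
    if "R \<in> planar_rels m n"
  proof -
    from that obtain fs gs where R: "R = rel fs gs" "length fs = m" "length gs = n"
      "noncrossing (gs @ rev fs)" by (rule planar_relsE)
    then consider "reducible fs gs" | "reducible gs fs" | "fs = gs" "distinct fs"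
      using irreducible_identity by blast
    then show ?thesis
    proof cases
      case 1
      then show ?thesis using reducible_planar_cap[of fs gs m] R by blast
    next
      case 2
      then obtain k i where "n = k + 1" "i < 2 * k + 1"
          "rel gs fs = (planar_cap k i)\<inverse> O (planar_cap k i O rel gs fs)"
        using reducible_planar_cap[of gs fs n] R by blast
      then show ?thesis using reduce_right R(1) by blast
    next
      case 3
      then show ?thesis using rel_distinct R by blast
    qed
  qed
  show "planar_cap m i O R \<in> planar_rels m n" if "i < 2 * m + 1" "R \<in> planar_rels (m + 1) n"
    using that by (rule planar_cap_mem)
  show "(planar_cap m i)\<inverse> O R \<in> planar_rels (m + 1) n" if "i < 2 * m + 1" "R \<in> planar_rels m n"
    using that by (rule planar_cup_mem)
  show "id_rel m \<in> planar_rels m m" by (rule id_planar)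
  show "id_rel m O R = R" if "R \<in> planar_rels m n" using that by (rule id_left_planar)
  show "R\<inverse> \<in> planar_rels n m" if "R \<in> planar_rels m n" using that by (rule planar_conv)
qed simp

interpretation TL_chain: cap_chain TL_rels id_rel 2 "\<lambda>m. m + 1" "\<lambda>m i. pair_rel i m"
proof
  fix m n i R
  show "pair_rel i m O (pair_rel i m)\<inverse> = id_rel m" if "i < m + 1"
    using that by (simp add: pair_pair)
  show "pair_rel i m O (pair_rel (Suc i) m)\<inverse> = id_rel m" if "Suc i < m + 1"
    using that by (simp add: pair_pair_Suc)
  show "pair_rel i m \<in> TL_rels m (m + 2)" if "i < m + 1"
    using pair_comp_TL[of i m "id_rel (m + 2)"] pair_rel_id[of i m] that by (simp add: id_TL)
  show "m = n \<and> R = id_rel m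
      \<or> (\<exists>k i. m = k + 2 \<and> i < k + 1 \<and> R = (pair_rel i k)\<inverse> O (pair_rel i k O R))
      \<or> (\<exists>k i. n = k + 2 \<and> i < k + 1 \<and> R = (R O (pair_rel i k)\<inverse>) O pair_rel i k)"
    if "R \<in> TL_rels m n"
  proof -
    from that obtain fs gs where R: "R = rel fs gs" "length fs = m" "length gs = n"
      "noncrossing (gs @ rev fs)" "paired (gs @ rev fs)" by (rule TL_relsE)
    then consider "reducible fs gs" | "reducible gs fs" | "fs = gs" "distinct fs"
      using irreducible_identity by blast
    then show ?thesis
    proof cases
      case 1
      then show ?thesis using reducible_pair_rel[of fs gs m] R by blast
    next
      case 2
      then obtain k i where "n = k + 2" "i < k + 1"
          "rel gs fs = (pair_rel i k)\<inverse> O (pair_rel i k O rel gs fs)"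
        using reducible_pair_rel[of gs fs n] R paired_swap[OF R(5)] by blast
      then show ?thesis using reduce_right R(1) by blast
    next
      case 3
      then show ?thesis using rel_distinct R by blast
    qed
  qed
  show "pair_rel i m O R \<in> TL_rels m n" if "i < m + 1" "R \<in> TL_rels (m + 2) n"
    using pair_comp_TL[of i m R n] that by simp
  show "(pair_rel i m)\<inverse> O R \<in> TL_rels (m + 2) n" if "i < m + 1" "R \<in> TL_rels m n"
    using pair_conv_comp_TL[of i m R n] that by simp
  show "id_rel m \<in> TL_rels m m" by (rule id_TL)
  show "id_rel m O R = R" if "R \<in> TL_rels m n" using that by (rule id_left_TL)
  show "R\<inverse> \<in> TL_rels n m" if "R \<in> TL_rels m n" using that by (rule TL_conv)
qed simp

section \<open>Partitions as colourings\<close>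

lemma finite_verts: "finite (verts m n)"
  by (simp add: verts_def)

text \<open>The vertices in anticlockwise order along the boundary of the rectangle, starting from \<open>1'\<close>.\<close>

definition vlist :: "nat \<Rightarrow> nat \<Rightarrow> vertex list" where
  "vlist m n = map Primed [1..<Suc n] @ rev (map Unprimed [1..<Suc m])"

lemma set_vlist: "set (vlist m n) = verts m n"
  by (auto simp: vlist_def verts_def atLeastLessThanSuc_atLeastAtMost simp del: upt_Suc)

lemma distinct_vlist: "distinct (vlist m n)"
  by (auto simp: vlist_def distinct_map inj_on_def simp del: upt_Suc)

text \<open>The partition into the colour classes of \<open>\<kappa>\<close>.\<close>

definition part_of :: "nat \<Rightarrow> nat \<Rightarrow> (vertex \<Rightarrow> nat) \<Rightarrow> part" where
  "part_of m n \<kappa> = {{v \<in> verts m n. \<kappa> v = \<kappa> u} | u. u \<in> verts m n}"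

lemma part_of_partition: "part_of m n \<kappa> \<in> partitions m n"
  unfolding partitions_def part_of_def by (auto intro!: partition_onI simp: disjnt_def)

lemma partition_colouring:
  assumes "\<alpha> \<in> partitions m n" obtains \<kappa> where "\<alpha> = part_of m n \<kappa>"
proof -
  have p: "partition_on (verts m n) \<alpha>" using assms by (simp add: partitions_def)
  then have "finite \<alpha>" using finite_elements finite_verts by blast
  then obtain c :: "vertex set \<Rightarrow> nat" where c: "inj_on c \<alpha>"
    using finite_imp_inj_to_nat_seg by blast
  define \<kappa> where "\<kappa> v = c (THE B. B \<in> \<alpha> \<and> v \<in> B)" for v
  have \<kappa>: "\<kappa> v = c B" if "B \<in> \<alpha>" "v \<in> B" for v B
  proof -
    have "(THE B. B \<in> \<alpha> \<and> v \<in> B) = B"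
      using that partition_onD2[OF p] by (intro the_equality) (auto simp: disjoint_def)
    then show ?thesis by (simp add: \<kappa>_def)
  qed
  have ex: "\<exists>B\<in>\<alpha>. v \<in> B" if "v \<in> verts m n" for v
    using that partition_onD1[OF p] by auto
  have sub: "B \<subseteq> verts m n" if "B \<in> \<alpha>" for B
    using that partition_onD1[OF p] by auto
  have cls: "{v \<in> verts m n. \<kappa> v = \<kappa> u} = B" if "B \<in> \<alpha>" "u \<in> B" for u B
  proof (intro equalityI subsetI)
    fix v assume "v \<in> {v \<in> verts m n. \<kappa> v = \<kappa> u}"
    then have v: "v \<in> verts m n" "\<kappa> v = \<kappa> u" by auto
    with ex obtain B' where B': "B' \<in> \<alpha>" "v \<in> B'" by blast
    then have "c B' = c B" using v \<kappa> that by metis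
    then show "v \<in> B" using B' c that by (auto dest: inj_onD)
  qed (use that sub \<kappa> in auto)
  have "\<alpha> = part_of m n \<kappa>"
  proof (intro equalityI subsetI)
    fix B assume B: "B \<in> \<alpha>"
    then obtain u where u: "u \<in> B" using partition_onD3[OF p] by (cases "B = {}") auto
    then show "B \<in> part_of m n \<kappa>" using cls[OF B u] sub[OF B] unfolding part_of_def by blast
  next
    fix B assume "B \<in> part_of m n \<kappa>"
    then obtain u where "u \<in> verts m n" "B = {v \<in> verts m n. \<kappa> v = \<kappa> u}"
      unfolding part_of_def by blast
    then show "B \<in> \<alpha>" using ex cls by metis
  qed
  then show ?thesis by (rule that)
qed

text \<open>The labeling of the vertices given by the words \<open>f\<close> on the upper and \<open>g\<close> on the lower vertices. Words
  are indexed from 0 and vertices from 1; the value at \<open>DPrimed\<close> vertices is irrelevant.\<close>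

fun lab :: "'c list \<Rightarrow> 'c list \<Rightarrow> vertex \<Rightarrow> 'c" where
  "lab f g (Unprimed i) = f ! (i - 1)"
| "lab f g (Primed i) = g ! (i - 1)"
| "lab f g (DPrimed i) = undefined"

text \<open>The words that \<open>\<kappa>\<close> spells on the upper and on the lower vertices.\<close>

definition upper :: "nat \<Rightarrow> (vertex \<Rightarrow> 'c) \<Rightarrow> 'c list" where
  "upper m \<kappa> = map (\<lambda>i. \<kappa> (Unprimed i)) [1..<Suc m]"

definition lower :: "nat \<Rightarrow> (vertex \<Rightarrow> 'c) \<Rightarrow> 'c list" where
  "lower n \<kappa> = map (\<lambda>i. \<kappa> (Primed i)) [1..<Suc n]"

lemma length_upper [simp]: "length (upper m \<kappa>) = m" by (simp add: upper_def)
lemma length_lower [simp]: "length (lower n \<kappa>) = n" by (simp add: lower_def)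

lemma map_upper: "map h (upper m \<kappa>) = upper m (h \<circ> \<kappa>)" by (simp add: upper_def)
lemma map_lower: "map h (lower m \<kappa>) = lower m (h \<circ> \<kappa>)" by (simp add: lower_def)

lemma map_vlist: "map \<kappa> (vlist m n) = lower n \<kappa> @ rev (upper m \<kappa>)"
  by (simp add: vlist_def lower_def upper_def rev_map comp_def del: upt_Suc)

lemma lab_upper_lower: "v \<in> verts m n \<Longrightarrow> lab (upper m \<kappa>) (lower n \<kappa>) v = \<kappa> v"
  by (auto simp: verts_def upper_def lower_def nth_upt simp del: upt_Suc)

lemma upper_lab: "length f = m \<Longrightarrow> upper m (lab f g) = f"
  by (intro nth_equalityI) (auto simp: upper_def nth_upt simp del: upt_Suc)

lemma lower_lab: "length g = n \<Longrightarrow> lower n (lab f g) = g"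
  by (intro nth_equalityI) (auto simp: lower_def nth_upt simp del: upt_Suc)

lemma upper_cong: "(\<And>v. v \<in> verts m n \<Longrightarrow> \<kappa> v = \<kappa>' v) \<Longrightarrow> upper m \<kappa> = upper m \<kappa>'"
  by (auto simp: upper_def verts_def)

lemma lower_cong: "(\<And>v. v \<in> verts m n \<Longrightarrow> \<kappa> v = \<kappa>' v) \<Longrightarrow> lower n \<kappa> = lower n \<kappa>'"
  by (auto simp: lower_def verts_def)

text \<open>The block-constant Boolean labelings of a partition.\<close>

definition labelings :: "nat \<Rightarrow> nat \<Rightarrow> part \<Rightarrow> bool list rel" where
  "labelings m n \<alpha> = {(f, g). length f = m \<and> length g = n \<and>
     (\<forall>B\<in>\<alpha>. \<forall>u\<in>B. \<forall>v\<in>B. lab f g u = lab f g v)}"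

lemma labelings_part_of: "labelings m n (part_of m n \<kappa>) = rel (upper m \<kappa>) (lower n \<kappa>)"
proof (intro equalityI subrelI)
  fix f g assume "(f, g) \<in> labelings m n (part_of m n \<kappa>)"
  then have len: "length f = m" "length g = n"
    and eq: "\<And>u v. u \<in> verts m n \<Longrightarrow> v \<in> verts m n \<Longrightarrow> \<kappa> u = \<kappa> v \<Longrightarrow> lab f g u = lab f g v"
    unfolding labelings_def part_of_def by auto
  define h where "h c \<longleftrightarrow> (\<exists>v\<in>verts m n. \<kappa> v = c \<and> lab f g v)" for c
  have h: "lab f g v = (h \<circ> \<kappa>) v" if "v \<in> verts m n" for v
    using that eq unfolding h_def comp_def by metis
  have "upper m (lab f g) = upper m (h \<circ> \<kappa>)" "lower n (lab f g) = lower n (h \<circ> \<kappa>)"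
    by (rule upper_cong lower_cong; erule h)+
  then show "(f, g) \<in> rel (upper m \<kappa>) (lower n \<kappa>)"
    using len unfolding rel_iff map_upper map_lower by (metis upper_lab lower_lab)
next
  fix f g assume "(f, g) \<in> rel (upper m \<kappa>) (lower n \<kappa>)"
  then obtain h where "f = upper m (h \<circ> \<kappa>)" "g = lower n (h \<circ> \<kappa>)"
    unfolding rel_iff map_upper map_lower by blast
  then show "(f, g) \<in> labelings m n (part_of m n \<kappa>)"
    unfolding labelings_def part_of_def by (auto simp: lab_upper_lower)
qed

lemma labelings_inj:
  assumes "\<alpha> \<in> partitions m n" "\<beta> \<in> partitions m n" "labelings m n \<alpha> = labelings m n \<beta>"
  shows "\<alpha> = \<beta>"
proof -
  obtain \<kappa> where \<kappa>: "\<alpha> = part_of m n \<kappa>" using partition_colouring[OF assms(1)] .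
  obtain \<mu> where \<mu>: "\<beta> = part_of m n \<mu>" using partition_colouring[OF assms(2)] .
  have "\<nu> u = \<nu> v"
    if "rel (upper m \<kappa>) (lower n \<kappa>) = rel (upper m \<nu>) (lower n \<nu>)" "\<kappa> u = \<kappa> v"
      "u \<in> verts m n" "v \<in> verts m n" for u v and \<kappa> \<nu> :: "vertex \<Rightarrow> nat"
  proof -
    define h where "h c \<longleftrightarrow> c = \<nu> u" for c
    have "(map h (upper m \<nu>), map h (lower n \<nu>)) \<in> rel (upper m \<kappa>) (lower n \<kappa>)"
      unfolding that(1) rel_iff by blast
    then obtain h' where "upper m (h \<circ> \<nu>) = upper m (h' \<circ> \<kappa>)" "lower n (h \<circ> \<nu>) = lower n (h' \<circ> \<kappa>)"
      unfolding rel_iff map_upper map_lower by blast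
    then have "(h \<circ> \<nu>) w = (h' \<circ> \<kappa>) w" if "w \<in> verts m n" for w
      using that lab_upper_lower by metis
    from this[of u] this[of v] show ?thesis using that by (simp add: h_def)
  qed
  note this[of \<kappa> \<mu>] this[of \<mu> \<kappa>]
  then have "\<kappa> u = \<kappa> v \<longleftrightarrow> \<mu> u = \<mu> v" if "u \<in> verts m n" "v \<in> verts m n" for u v
    using that assms(3) unfolding \<kappa> \<mu> labelings_part_of by metis
  then show ?thesis unfolding \<kappa> \<mu> part_of_def by blast
qed

lemma card_blocks_part_of:
  "(\<forall>B\<in>part_of m n \<kappa>. card B = 2) \<longleftrightarrow> paired (map \<kappa> (vlist m n))"
proof -
  have "count_list (map \<kappa> xs) c = length (filter (\<lambda>v. \<kappa> v = c) xs)" for xs c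
    by (induction xs) auto
  moreover have "length (filter (\<lambda>v. \<kappa> v = c) (vlist m n)) = card {v \<in> verts m n. \<kappa> v = c}" for c
    using distinct_card[OF distinct_filter[OF distinct_vlist[of m n]], of "\<lambda>v. \<kappa> v = c"]
    by (simp add: set_vlist[symmetric])
  moreover have "(\<forall>B\<in>part_of m n \<kappa>. card B = 2) \<longleftrightarrow>
      (\<forall>u\<in>verts m n. card {v \<in> verts m n. \<kappa> v = \<kappa> u} = 2)"
    unfolding part_of_def by blast
  ultimately show ?thesis
    by (simp add: paired_def set_vlist)
qed

section \<open>Planar partitions are noncrossing\<close>

text \<open>The order in which \<open>vlist\<close> lists the vertices.\<close>

fun before :: "vertex \<Rightarrow> vertex \<Rightarrow> bool" where
  "before (Primed i) (Primed j) \<longleftrightarrow> i < j"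
| "before (Primed i) (Unprimed j) \<longleftrightarrow> True"
| "before (Unprimed i) (Unprimed j) \<longleftrightarrow> j < i"
| "before _ _ \<longleftrightarrow> False"

lemma vlist_before:
  assumes "p < q" "q < length (vlist m n)" shows "before (vlist m n ! p) (vlist m n ! q)"
proof -
  have "sorted_wrt before (vlist m n)"
    unfolding vlist_def sorted_wrt_append sorted_wrt_rev sorted_wrt_map
    using sorted_wrt_upt by (auto simp del: upt_Suc)
  then show ?thesis using assms by (rule sorted_wrt_nth_less)
qed

lemma vector2_eq_iff: "(vector [a, b] :: real^2) = vector [c, d] \<longleftrightarrow> a = c \<and> b = d"
  by (metis vector_2)

lemma vector2_eqI: "z $ 1 = w $ 1 \<Longrightarrow> z $ 2 = w $ 2 \<Longrightarrow> (z :: real^2) = w"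
  by (simp add: vec_eq_iff forall_2)

lemma mem_cbox_2: "z \<in> cbox (vector [a, b]) (vector [c, d] :: real^2) \<longleftrightarrow>
    a \<le> z $ 1 \<and> z $ 1 \<le> c \<and> b \<le> z $ 2 \<and> z $ 2 \<le> d"
  by (auto simp: mem_box_cart forall_2)

lemma continuous_on_vector2:
  "continuous_on S f \<Longrightarrow> continuous_on S g \<Longrightarrow> continuous_on S (\<lambda>x. vector [f x, g x] :: real^2)"
proof -
  have "(\<lambda>x. vector [f x, g x] :: real^2) = (\<lambda>x. \<chi> i. if i = 1 then f x else g x)"
    by (auto simp: fun_eq_iff vec_eq_iff forall_2)
  moreover assume "continuous_on S f" "continuous_on S g"
  moreover from this have "continuous_on S (\<lambda>x. if i = 1 then f x else g x)" for i :: 2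
    by (cases "i = 1") simp_all
  ultimately show ?thesis
    by (simp only: continuous_on_vec_lambda)
qed

lemma inj_on_position: "inj_on position (verts m n)"
  by (auto simp: inj_on_def verts_def vector2_eq_iff)

lemma position_mem_cbox:
  "v \<in> verts m n \<Longrightarrow> position v \<in> cbox (vector [1, 0]) (vector [real (max m n), 1])"
  by (auto simp: verts_def mem_cbox_2)

text \<open>The rectangle is bent open around its right side: the lower side is mapped to the negative and the
  upper side to the positive part of the first axis, so that all vertices lie on one line, in their
  order on the boundary. The vertical segment at \<open>x\<close> is mapped to the polygonal arc
  \<open>\<bar>X\<bar> + Y = N + 1 - x\<close>, and such arcs are disjoint for different \<open>x \<le> N\<close>.\<close>

definition fold_open :: "real \<Rightarrow> real^2 \<Rightarrow> real^2" where
  "fold_open N z = vector [(N + 1 - z $ 1) * (2 * z $ 2 - 1), (N + 1 - z $ 1) * (1 - \<bar>2 * z $ 2 - 1\<bar>)]"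

lemma continuous_on_fold_open: "continuous_on S (fold_open N)"
  unfolding fold_open_def by (intro continuous_on_vector2 continuous_intros)

lemma inj_on_fold_open: "inj_on (fold_open N) {z. z $ 1 \<le> N}"
proof (rule inj_onI)
  fix z w :: "real^2"
  assume "z \<in> {z. z $ 1 \<le> N}" "w \<in> {z. z $ 1 \<le> N}" and eq: "fold_open N z = fold_open N w"
  define s t where "s = N + 1 - z $ 1" and "t = N + 1 - w $ 1"
  define a b where "a = 2 * z $ 2 - 1" and "b = 2 * w $ 2 - 1"
  have st: "s > 0" "t > 0" using \<open>z \<in> _\<close> \<open>w \<in> _\<close> by (auto simp: s_def t_def)
  have 1: "s * a = t * b" and 2: "s * (1 - \<bar>a\<bar>) = t * (1 - \<bar>b\<bar>)"
    using eq by (auto simp: fold_open_def vector2_eq_iff s_def t_def a_def b_def)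
  have "s * \<bar>a\<bar> = t * \<bar>b\<bar>" using arg_cong[OF 1, of abs] st by (simp add: abs_mult)
  then have "s = t" using 2 by (simp add: algebra_simps)
  then have "a = b" using 1 st by simp
  then show "z = w" using \<open>s = t\<close> by (intro vector2_eqI) (auto simp: s_def t_def a_def b_def)
qed

lemma fold_open_mem_cbox:
  assumes "z \<in> cbox (vector [1, 0]) (vector [N, 1])"
  shows "fold_open N z \<in> cbox (vector [- N, 0]) (vector [N, N])"
proof -
  define s u where "s = N + 1 - z $ 1" and "u = 2 * z $ 2 - 1"
  have s: "1 \<le> s" "s \<le> N" and u: "\<bar>u\<bar> \<le> 1"
    using assms by (auto simp: mem_cbox_2 s_def u_def)
  have "\<bar>s * u\<bar> \<le> s" using s u mult_left_le[of "\<bar>u\<bar>" s] by (simp add: abs_mult)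
  moreover have "0 \<le> s * (1 - \<bar>u\<bar>)" "s * (1 - \<bar>u\<bar>) \<le> s"
    using s u mult_left_le[of "1 - \<bar>u\<bar>" s] by auto
  ultimately show ?thesis
    using s unfolding mem_cbox_2 fold_open_def s_def[symmetric] u_def[symmetric] vector_2 by linarith
qed

lemma component_class:
  assumes "graph_components V E = part_of m n \<kappa>" "V = verts m n" "u \<in> V" "v \<in> V"
  shows "(u, v) \<in> {(x, y). {x, y} \<in> E}\<^sup>* \<longleftrightarrow> \<kappa> u = \<kappa> v"
proof -
  let ?r = "{(u, v). u \<in> V \<and> v \<in> V \<and> (u, v) \<in> {(x, y). {x, y} \<in> E}\<^sup>*}"
  have "?r `` {u} \<in> part_of m n \<kappa>"
    using quotientI[OF assms(3), of ?r] assms(1) unfolding graph_components_def by simp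
  then obtain w where "?r `` {u} = {v \<in> V. \<kappa> v = \<kappa> w}"
    using assms(2) unfolding part_of_def by blast
  moreover have "u \<in> ?r `` {u}" using assms(3) by auto
  ultimately have "?r `` {u} = {v \<in> V. \<kappa> v = \<kappa> u}" by auto
  then have "v \<in> ?r `` {u} \<longleftrightarrow> \<kappa> v = \<kappa> u" using assms(4) by blast
  then show ?thesis using assms(3,4) by auto
qed

text \<open>The arcs of a drawing that belong to one block form a path-connected set, and the sets of different
  blocks are disjoint. If two blocks interleaved, bending the rectangle open would give disjoint paths
  whose ends interlace on a line bounding a half-plane that contains them, which the Fashoda theorem
  excludes.\<close>

lemma planar_imp_noncrossing:
  assumes "planar m n (part_of m n \<kappa>)"
  shows "noncrossing (map \<kappa> (vlist m n))"
proof -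
  let ?V = "verts m n" and ?N = "real (max m n)" and ?vl = "vlist m n"
  let ?R = "cbox (vector [1, 0]) (vector [?N, 1]) :: (real^2) set"
  obtain E \<gamma> where E: "graph_on ?V E" "graph_components ?V E = part_of m n \<kappa>" "drawing m n E \<gamma>"
    using assms unfolding planar_def by blast
  note cls = component_class[OF E(2) refl]
  have edge: "arc (\<gamma> e)" "{pathstart (\<gamma> e), pathfinish (\<gamma> e)} = position ` e"
      "path_image (\<gamma> e) \<subseteq> ?R" "path_image (\<gamma> e) \<inter> position ` ?V = position ` e" "e \<subseteq> ?V"
    if "e \<in> E" for e
    using bspec[OF conjunct1[OF E(3)[unfolded drawing_def]] that]
      bspec[OF E(1)[unfolded graph_on_def] that] by simp_all
  have meet: "path_image (\<gamma> e) \<inter> path_image (\<gamma> f) \<subseteq> position ` (e \<inter> f)"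
    if "e \<in> E" "f \<in> E" "e \<noteq> f" for e f
    using conjunct2[OF E(3)[unfolded drawing_def]] that by simp
  \<comment> \<open>The part of the drawing that belongs to the block of colour \<open>c\<close>.\<close>
  define S where "S c = position ` {v \<in> ?V. \<kappa> v = c} \<union>
    (\<Union>e\<in>{e \<in> E. \<forall>v\<in>e. \<kappa> v = c}. path_image (\<gamma> e))" for c
  have S_sub: "S c \<subseteq> ?R" for c
    unfolding S_def using edge(3) position_mem_cbox by blast
  have disj: "S c \<inter> S d = {}" if "c \<noteq> d" for c d
  proof -
    have "False" if z: "z \<in> S c" "z \<in> S d" for z
    proof -
      have vv: False if "z = position u" "z = position v" "u \<in> ?V" "v \<in> ?V" "\<kappa> u = c" "\<kappa> v = d" for u v
        using that inj_onD[OF inj_on_position[of m n], of u v] \<open>c \<noteq> d\<close> by auto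
      have ve: False if "z = position u" "u \<in> ?V" "e \<in> E" "z \<in> path_image (\<gamma> e)" "\<forall>v\<in>e. \<kappa> v \<noteq> \<kappa> u" for u e
      proof -
        have "z \<in> position ` e" using edge(4)[OF that(3)] that by blast
        then obtain v where "v \<in> e" "z = position v" by blast
        then have "u = v" using that edge(5)[OF that(3)] inj_onD[OF inj_on_position[of m n], of u v] by auto
        then show False using that \<open>v \<in> e\<close> by blast
      qed
      have ee: False if "e \<in> E" "f \<in> E" "z \<in> path_image (\<gamma> e)" "z \<in> path_image (\<gamma> f)"
        "\<forall>v\<in>e. \<kappa> v = c" "\<forall>v\<in>f. \<kappa> v = d" for e f
      proof -
        have "e \<inter> f = {}" using that \<open>c \<noteq> d\<close> by auto
        moreover have "e \<noteq> {}" using that(1) E(1) unfolding graph_on_def by fastforce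
        ultimately have "z \<in> position ` {}" using meet[OF that(1,2)] that(3,4) by blast
        then show False by simp
      qed
      have mem: "(\<exists>u\<in>?V. \<kappa> u = k \<and> z = position u) \<or>
          (\<exists>e\<in>E. (\<forall>v\<in>e. \<kappa> v = k) \<and> z \<in> path_image (\<gamma> e))" if "z \<in> S k" for k
        using that unfolding S_def by auto
      show False
        using mem[OF z(1)] mem[OF z(2)] \<open>c \<noteq> d\<close> vv ve ee by metis
    qed
    then show ?thesis by blast
  qed
  have conn: "path_component (S (\<kappa> u)) (position u) (position v)"
    if "u \<in> ?V" "v \<in> ?V" "\<kappa> u = \<kappa> v" for u v
  proof -
    have "(u, v) \<in> {(x, y). {x, y} \<in> E}\<^sup>*" using cls that by blast
    then show ?thesis
    proof induction
      case base
      have "position u \<in> S (\<kappa> u)" using that unfolding S_def by blast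
      then show ?case by (simp add: path_component_refl)
    next
      case (step y z)
      let ?e = "{y, z}"
      have e: "?e \<in> E" using step by simp
      then have yz: "y \<in> ?V" "z \<in> ?V" using edge(5) by blast+
      have "\<kappa> y = \<kappa> u" using cls[OF \<open>u \<in> ?V\<close> yz(1)] step(1) by simp
      moreover have "(u, z) \<in> {(x, y). {x, y} \<in> E}\<^sup>*" by (rule rtrancl_into_rtrancl[OF step(1,2)])
      then have "\<kappa> z = \<kappa> u" using cls[OF \<open>u \<in> ?V\<close> yz(2)] by simp
      ultimately have sub: "path_image (\<gamma> ?e) \<subseteq> S (\<kappa> u)" using e unfolding S_def by blast
      have "path_component (S (\<kappa> u)) (pathstart (\<gamma> ?e)) (pathfinish (\<gamma> ?e))"
        unfolding path_component_def using sub edge(1)[OF e] arc_imp_path by blast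
      moreover have "{pathstart (\<gamma> ?e), pathfinish (\<gamma> ?e)} = {position y, position z}"
        using edge(2)[OF e] by simp
      ultimately have "path_component (S (\<kappa> u)) (position y) (position z)"
        by (metis doubleton_eq_iff path_component_sym)
      with step(3) show ?case by (rule path_component_trans)
    qed
  qed
  show ?thesis
    unfolding noncrossing_def
  proof (intro allI impI, rule ccontr)
    fix a b c d
    assume ord: "a < b" "b < c" "c < d" "d < length (map \<kappa> ?vl)"
      and eq: "map \<kappa> ?vl ! a = map \<kappa> ?vl ! c" "map \<kappa> ?vl ! b = map \<kappa> ?vl ! d"
      and ne: "map \<kappa> ?vl ! a \<noteq> map \<kappa> ?vl ! b"
    let ?a = "?vl ! a" and ?b = "?vl ! b" and ?c = "?vl ! c" and ?d = "?vl ! d"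
    have V: "?a \<in> ?V" "?b \<in> ?V" "?c \<in> ?V" "?d \<in> ?V"
      using ord by (auto simp: set_vlist[symmetric])
    have \<kappa>: "\<kappa> ?a = \<kappa> ?c" "\<kappa> ?b = \<kappa> ?d" "\<kappa> ?a \<noteq> \<kappa> ?b" using ord eq ne by auto
    obtain f where f: "path f" "path_image f \<subseteq> S (\<kappa> ?a)" "pathstart f = position ?a" "pathfinish f = position ?c"
      using conn[of ?a ?c] V \<kappa> unfolding path_component_def by auto
    obtain g where g: "path g" "path_image g \<subseteq> S (\<kappa> ?b)" "pathstart g = position ?b" "pathfinish g = position ?d"
      using conn[of ?b ?d] V \<kappa> unfolding path_component_def by auto
    let ?\<phi> = "fold_open ?N"
    have mono: "?\<phi> (position u) $ 1 < ?\<phi> (position v) $ 1" if "before u v" "u \<in> ?V" "v \<in> ?V" for u v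
      using that by (cases u; cases v) (auto simp: fold_open_def verts_def simp del: of_nat_max)
    have zero: "?\<phi> (position u) $ 2 = 0" if "u \<in> ?V" for u
      using that by (cases u) (auto simp: fold_open_def verts_def)
    have img: "path_image (?\<phi> \<circ> h) \<subseteq> cbox (vector [- ?N, 0]) (vector [?N, ?N])"
      if "path_image h \<subseteq> S k" for h k
      using that S_sub fold_open_mem_cbox unfolding path_image_compose by blast
    obtain z where "z \<in> path_image (?\<phi> \<circ> f)" "z \<in> path_image (?\<phi> \<circ> g)"
    proof (rule fashoda_interlace[of "?\<phi> \<circ> f" "?\<phi> \<circ> g"])
      show "path (?\<phi> \<circ> f)" "path (?\<phi> \<circ> g)"
        using f g by (auto intro!: path_continuous_image continuous_on_fold_open)
      show "path_image (?\<phi> \<circ> f) \<subseteq> cbox (vector [- ?N, 0]) (vector [?N, ?N])"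
        "path_image (?\<phi> \<circ> g) \<subseteq> cbox (vector [- ?N, 0]) (vector [?N, ?N])"
        using f g img by blast+
    qed (use ord V f g in \<open>auto simp: pathstart_compose pathfinish_compose zero intro!: mono vlist_before\<close>)
    then obtain x y where xy: "x \<in> path_image f" "y \<in> path_image g" "?\<phi> x = ?\<phi> y"
      unfolding path_image_compose by auto
    then have "x \<in> ?R" "y \<in> ?R" using f g S_sub by blast+
    then have "x \<in> {z. z $ 1 \<le> ?N}" "y \<in> {z. z $ 1 \<le> ?N}" unfolding mem_cbox_2 by simp_all
    then have "x = y" using inj_onD[OF inj_on_fold_open xy(3)] by blast
    then show False using xy f(2) g(2) disj[OF \<kappa>(3)] by blast
  qed
qed

section \<open>Noncrossing partitions are planar\<close>

text \<open>Noncrossing partitions are drawn with straight chords in a lens, whose lower and upper boundary are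
  the parabolas \<open>- bulge N\<close> and \<open>1 + bulge N\<close>, and the lens is then straightened to the rectangle. The
  vertices lie in strictly convex position on the boundary of the lens, so that chords cross only if
  their ends interleave.\<close>

definition bulge :: "real \<Rightarrow> real \<Rightarrow> real" where
  "bulge N x = (x - 1) * (N - x)"

lemma bulge_nonneg: "1 \<le> x \<Longrightarrow> x \<le> N \<Longrightarrow> 0 \<le> bulge N x"
  by (simp add: bulge_def)

fun lens_point :: "real \<Rightarrow> vertex \<Rightarrow> real \<times> real" where
  "lens_point N (Primed x) = (x, - bulge N x)"
| "lens_point N (Unprimed x) = (x, 1 + bulge N x)"
| "lens_point N (DPrimed x) = undefined"

text \<open>Twice the signed area of the triangle \<open>p q r\<close>, which is positive for an anticlockwise triangle.\<close>

definition orient :: "real \<times> real \<Rightarrow> real \<times> real \<Rightarrow> real \<times> real \<Rightarrow> real" where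
  "orient p q r = (fst q - fst p) * (snd r - snd p) - (snd q - snd p) * (fst r - fst p)"

lemma orient_cyclic: "orient p q r = orient q r p"
  by (simp add: orient_def algebra_simps)

lemma orient_swap: "orient p q r = - orient q p r"
  by (simp add: orient_def algebra_simps)

lemma orient_same: "orient p q p = 0" "orient p q q = 0"
  by (simp_all add: orient_def algebra_simps)

lemma orient_affine:
  "orient p q ((1 - t) *\<^sub>R r + t *\<^sub>R s) = (1 - t) * orient p q r + t * orient p q s"
  by (simp add: orient_def algebra_simps)

text \<open>The extended chord of the parabola \<open>bulge N\<close> through \<open>i\<close> and \<open>j\<close> has the value
  \<open>bulge N k + (k - i) * (k - j)\<close> at \<open>k\<close>. Up to a reflection, the bound says that this line and the opposite side of the
  lens do not meet.\<close>

lemma chord_bound: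
  assumes "1 \<le> i" "i \<le> N" "1 \<le> j" "j \<le> N" "1 \<le> k" "k \<le> N"
  shows "0 < 1 + 2 * bulge N k + (k - i) * (k - j)"
proof -
  have *: "(k - a) * (b - k) \<le> bulge N k" if "1 \<le> a" "a \<le> k" "k \<le> b" "b \<le> N" for a b
    unfolding bulge_def using that by (intro mult_mono) auto
  have "- bulge N k \<le> (k - i) * (k - j)"
  proof (cases "i \<le> k \<longleftrightarrow> k \<le> j")
    case True
    then consider "i \<le> k" "k \<le> j" | "k < i" "j < k" by linarith
    then show ?thesis
    proof cases
      case 1
      then show ?thesis using *[of i j] assms by (simp add: algebra_simps)
    next
      case 2
      then show ?thesis using *[of j i] assms by (simp add: algebra_simps)
    qed
  next
    case False
    then have "0 \<le> (k - i) * (k - j)" by (auto simp: zero_le_mult_iff)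
    then show ?thesis using bulge_nonneg[OF assms(5,6)] by linarith
  qed
  then show ?thesis using bulge_nonneg[OF assms(5,6)] by linarith
qed

lemma orient_bottom:
  "orient (i, - bulge N i) (j, - bulge N j) (k, - bulge N k) = (j - i) * (k - i) * (k - j)"
  by (simp add: orient_def bulge_def algebra_simps)

lemma orient_top:
  "orient (i, 1 + bulge N i) (j, 1 + bulge N j) (k, 1 + bulge N k) = (i - j) * (i - k) * (j - k)"
  by (simp add: orient_def bulge_def algebra_simps)

lemma orient_bottom_top:
  "orient (i, - bulge N i) (j, - bulge N j) (k, 1 + bulge N k) =
     (j - i) * (1 + 2 * bulge N k + (k - i) * (k - j))"
  by (simp add: orient_def bulge_def algebra_simps)

lemma orient_top_bottom:
  "orient (i, - bulge N i) (j, 1 + bulge N j) (k, 1 + bulge N k) =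
     (j - k) * (1 + 2 * bulge N i + (i - j) * (i - k))"
  by (simp add: orient_def bulge_def algebra_simps)

lemma orient_before:
  assumes "before u v" "before v w" "{u, v, w} \<subseteq> verts m n"
  shows "0 < orient (lens_point (max m n) u) (lens_point (max m n) v) (lens_point (max m n) w)"
proof -
  let ?N = "real (max m n)"
  show ?thesis
    using assms
    by (cases u; cases v; cases w)
      (auto simp: orient_bottom orient_top orient_bottom_top orient_top_bottom verts_def
        intro!: mult_pos_pos chord_bound simp del: of_nat_max)
qed

text \<open>The vertical rescaling that maps the lens to the rectangle.\<close>

definition straighten :: "real \<Rightarrow> real \<times> real \<Rightarrow> real^2" where
  "straighten N p = vector [fst p, (snd p + bulge N (fst p)) / (1 + 2 * bulge N (fst p))]"

definition lens :: "real \<Rightarrow> (real \<times> real) set" where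
  "lens N = {p. 1 \<le> fst p \<and> fst p \<le> N \<and> - bulge N (fst p) \<le> snd p \<and> snd p \<le> 1 + bulge N (fst p)}"

lemma bulge_concave:
  assumes "0 \<le> t" "t \<le> 1"
  shows "(1 - t) * bulge N x + t * bulge N y \<le> bulge N ((1 - t) * x + t * y)"
proof -
  have "bulge N ((1 - t) * x + t * y) - ((1 - t) * bulge N x + t * bulge N y)
      = t * (1 - t) * (x - y)\<^sup>2"
    by (simp add: bulge_def power2_eq_square algebra_simps)
  moreover have "0 \<le> t * (1 - t) * (x - y)\<^sup>2" using assms by simp
  ultimately show ?thesis by linarith
qed

lemma convex_lens: "convex (lens N)"
  unfolding convex_alt
proof (intro ballI allI impI)
  fix p q and t :: real assume *: "p \<in> lens N" "q \<in> lens N" "0 \<le> t \<and> t \<le> 1"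
  have c: "(1 - t) * bulge N (fst p) + t * bulge N (fst q) \<le> bulge N ((1 - t) * fst p + t * fst q)"
    using * by (intro bulge_concave) auto
  have mono: "(1 - t) * a + t * b \<le> (1 - t) * a' + t * b'" if "a \<le> a'" "b \<le> b'" for a b a' b'
    using that * by (intro add_mono mult_left_mono) auto
  have "(1 - t) * 1 + t * 1 \<le> (1 - t) * fst p + t * fst q"
    "(1 - t) * fst p + t * fst q \<le> (1 - t) * N + t * N"
    "(1 - t) * (- bulge N (fst p)) + t * (- bulge N (fst q)) \<le> (1 - t) * snd p + t * snd q"
    "(1 - t) * snd p + t * snd q \<le> (1 - t) * (1 + bulge N (fst p)) + t * (1 + bulge N (fst q))"
    using * unfolding lens_def by (intro mono; simp)+
  then show "(1 - t) *\<^sub>R p + t *\<^sub>R q \<in> lens N"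
    using c unfolding lens_def by (simp add: algebra_simps)
qed

lemma lens_point_mem: "v \<in> verts m n \<Longrightarrow> lens_point (max m n) v \<in> lens (max m n)"
  using bulge_nonneg[of _ "real (max m n)"]
  by (auto simp: verts_def lens_def simp del: of_nat_max)

lemma straighten_lens_point:
  assumes "v \<in> verts m n" shows "straighten (max m n) (lens_point (max m n) v) = position v"
proof -
  have *: "1 + 2 * bulge (max m n) x \<noteq> 0" if "1 \<le> x" "x \<le> real (max m n)" for x
    using bulge_nonneg[OF that] by linarith
  show ?thesis
    using assms *[of "real _"]
    by (auto simp: verts_def straighten_def vector2_eq_iff divide_eq_eq simp del: of_nat_max)
qed

lemma inj_on_straighten: "inj_on (straighten N) (lens N)"
proof (rule inj_onI)
  fix p q assume pq: "p \<in> lens N" "q \<in> lens N" "straighten N p = straighten N q"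
  then have "1 + 2 * bulge N (fst p) > 0" using bulge_nonneg[of "fst p" N] by (simp add: lens_def)
  then show "p = q" using pq(3) by (auto simp: straighten_def vector2_eq_iff prod_eq_iff)
qed

lemma straighten_mem_cbox: "p \<in> lens N \<Longrightarrow> straighten N p \<in> cbox (vector [1, 0]) (vector [N, 1])"
  using bulge_nonneg[of "fst p" N] by (simp add: lens_def straighten_def mem_cbox_2)

lemma continuous_on_straighten: "continuous_on (lens N) (straighten N)"
  unfolding straighten_def bulge_def
  by (intro continuous_on_vector2 continuous_intros)
    (use bulge_nonneg in \<open>fastforce simp: lens_def bulge_def\<close>)

text \<open>Let \<open>f\<close> be the affine function that vanishes on the line through the ends of the first chord. It is
  negative at the vertices strictly between \<open>a\<close> and \<open>b\<close> and positive at all other vertices except \<open>a\<close>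
  and \<open>b\<close>. If the ends do not interleave, then \<open>f\<close> does not change sign on the second chord and can
  vanish there only at a common end.\<close>

lemma chords_meet:
  assumes vl: "a < b" "b < length (vlist m n)" "c < d" "d < length (vlist m n)" "(a, b) \<noteq> (c, d)"
    and "\<not> (a < c \<and> c < b \<and> b < d)" "\<not> (c < a \<and> a < d \<and> d < b)"
    and z: "z \<in> closed_segment (P a) (P b)" "z \<in> closed_segment (P c) (P d)"
    and P: "\<And>k. P k = lens_point (max m n) (vlist m n ! k)"
  shows "\<exists>k\<in>{a, b} \<inter> {c, d}. z = P k"
proof -
  define f where "f = orient (P a) (P b)"
  have pos: "0 < orient (P i) (P j) (P k)" if "i < j" "j < k" "k < length (vlist m n)" for i j k
    unfolding P using that by (intro orient_before vlist_before) (auto simp: set_vlist[symmetric])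
  have inside: "f (P k) < 0" if "a < k" "k < b" for k
    using pos[of a k b] that vl orient_swap[of "P k" "P b" "P a"] orient_cyclic[of "P a" "P k" "P b"]
      orient_cyclic[of "P b" "P a" "P k"] orient_swap[of "P a" "P b" "P k"]
    unfolding f_def by linarith
  have outside: "0 < f (P k)" if "k < a \<or> b < k" "k < length (vlist m n)" for k
  proof (cases "k < a")
    case True
    then show ?thesis
      using pos[of k a b] vl orient_cyclic[of "P k" "P a" "P b"] unfolding f_def by simp
  next
    case False
    then show ?thesis using pos[of a b k] that vl unfolding f_def by simp
  qed
  have ends: "f (P a) = 0" "f (P b) = 0" by (simp_all add: f_def orient_same)
  obtain t where "z = (1 - t) *\<^sub>R P a + t *\<^sub>R P b" using z(1) by (auto simp: in_segment)
  then have "f z = 0" using ends unfolding f_def by (simp add: orient_affine)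
  moreover obtain s where s: "z = (1 - s) *\<^sub>R P c + s *\<^sub>R P d" "0 \<le> s" "s \<le> 1"
    using z(2) by (auto simp: in_segment)
  ultimately have sum: "(1 - s) * f (P c) + s * f (P d) = 0"
    unfolding f_def by (simp add: orient_affine)
  have zero: "f (P k) = 0 \<longleftrightarrow> k \<in> {a, b}" if "k < length (vlist m n)" for k
    using inside[of k] outside[of k] ends that by (cases "a < k \<and> k < b"; cases "k < a \<or> b < k") auto
  have sgn: "0 \<le> f (P c) \<and> 0 \<le> f (P d) \<or> f (P c) \<le> 0 \<and> f (P d) \<le> 0"
  proof (rule ccontr)
    assume "\<not> ?thesis"
    then have *: "f (P c) < 0 \<and> 0 < f (P d) \<or> 0 < f (P c) \<and> f (P d) < 0" by linarith
    have pos_iff: "0 < f (P k) \<Longrightarrow> k < a \<or> b < k" if "k < length (vlist m n)" for k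
      using inside[of k] ends that by (cases "k = a"; cases "k = b") force+
    have neg_iff: "f (P k) < 0 \<Longrightarrow> a < k \<and> k < b" if "k < length (vlist m n)" for k
      using outside[of k] ends that by (cases "k = a"; cases "k = b") force+
    show False
      using * pos_iff[of c] pos_iff[of d] neg_iff[of c] neg_iff[of d] vl assms(6,7) by linarith
  qed
  have "c \<notin> {a, b} \<or> d \<notin> {a, b}" using vl by auto
  then have nz: "f (P c) \<noteq> 0 \<or> f (P d) \<noteq> 0" using zero vl by auto
  have "(1 - s) * f (P c) = 0 \<and> s * f (P d) = 0"
    using sgn sum s(2,3)
    by (smt (verit) mult_nonneg_nonneg mult_nonneg_nonpos)
  then consider "s = 1" "f (P d) = 0" | "s = 0" "f (P c) = 0" using nz by auto
  then show ?thesis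
  proof cases
    case 1
    then show ?thesis using s(1) zero[of d] vl by (intro bexI[of _ d]) auto
  next
    case 2
    then show ?thesis using s(1) zero[of c] vl by (intro bexI[of _ c]) auto
  qed
qed

text \<open>Each block is drawn as a star whose centre, its \<open>root\<close>, is the first vertex of the block in boundary
  order.\<close>

lemma noncrossing_imp_planar:
  assumes nc: "noncrossing (map \<kappa> (vlist m n))"
  shows "planar m n (part_of m n \<kappa>)"
proof -
  let ?V = "verts m n" and ?N = "real (max m n)" and ?vl = "vlist m n"
  let ?L = "length ?vl"
  define P where "P k = lens_point ?N (?vl ! k)" for k
  define root where "root k = (LEAST j. \<kappa> (?vl ! j) = \<kappa> (?vl ! k))" for k
  have root_le: "root k \<le> k" and root_colour: "\<kappa> (?vl ! root k) = \<kappa> (?vl ! k)" for k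
    unfolding root_def by (auto intro: Least_le LeastI)
  have root_eq: "root j = root k" if "\<kappa> (?vl ! j) = \<kappa> (?vl ! k)" for j k
    using that by (simp add: root_def)
  define edge where "edge k = {?vl ! root k, ?vl ! k}" for k
  define E where "E = edge ` {k. k < ?L \<and> root k < k}"
  have vlV: "?vl ! k \<in> ?V" if "k < ?L" for k using that by (simp add: set_vlist[symmetric])
  have vl_inj: "?vl ! j = ?vl ! k \<longleftrightarrow> j = k" if "j < ?L" "k < ?L" for j k
    using that distinct_vlist by (simp add: nth_eq_iff_index_eq)
  have graph: "graph_on ?V E"
    unfolding graph_on_def E_def edge_def using vlV vl_inj root_le
    by (auto simp: card_2_iff dest: le_less_trans intro!: exI)
  let ?e = "{(x, y). {x, y} \<in> E}"
  have colour: "\<kappa> u = \<kappa> v" if "(u, v) \<in> ?e\<^sup>*" for u v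
    using that
  proof induction
    case (step y z)
    then obtain k where "{y, z} = edge k" by (auto simp: E_def)
    then have "\<kappa> y = \<kappa> z" using root_colour[of k] by (auto simp: edge_def doubleton_eq_iff)
    with step show ?case by simp
  qed simp
  have root_conn: "(?vl ! root k, ?vl ! k) \<in> ?e\<^sup>*" "(?vl ! k, ?vl ! root k) \<in> ?e\<^sup>*" if "k < ?L" for k
  proof -
    have "{?vl ! root k, ?vl ! k} \<in> E" if "root k \<noteq> k"
      using that root_le[of k] \<open>k < ?L\<close> unfolding E_def edge_def by (intro imageI) auto
    then show "(?vl ! root k, ?vl ! k) \<in> ?e\<^sup>*" "(?vl ! k, ?vl ! root k) \<in> ?e\<^sup>*"
      by (cases "root k = k"; auto simp: insert_commute intro!: r_into_rtrancl)+
  qed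
  have conn: "(u, v) \<in> ?e\<^sup>* \<longleftrightarrow> \<kappa> u = \<kappa> v" if uv: "u \<in> ?V" "v \<in> ?V" for u v
  proof
    obtain j k where jk: "j < ?L" "u = ?vl ! j" "k < ?L" "v = ?vl ! k"
      using uv unfolding set_vlist[symmetric] in_set_conv_nth by blast
    assume "\<kappa> u = \<kappa> v"
    then have "root j = root k" using root_eq[of j k] jk by simp
    then show "(u, v) \<in> ?e\<^sup>*"
      unfolding jk(2,4) using rtrancl_trans[OF root_conn(2)[OF jk(1)], of "?vl ! k"]
        root_conn(1)[OF jk(3)] by simp
  qed (rule colour)
  have comps: "graph_components ?V E = part_of m n \<kappa>"
  proof -
    have "{(u, v). u \<in> ?V \<and> v \<in> ?V \<and> (u, v) \<in> ?e\<^sup>*} = {(u, v). u \<in> ?V \<and> v \<in> ?V \<and> \<kappa> v = \<kappa> u}"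
      using conn by force
    then show ?thesis
      unfolding graph_components_def part_of_def by (auto simp: quotient_def)
  qed
  define \<gamma> where "\<gamma> e = (let k = (SOME k. k < ?L \<and> root k < k \<and> e = edge k)
    in straighten ?N \<circ> linepath (P (root k)) (P k))" for e
  have P_lens: "P k \<in> lens ?N" if "k < ?L" for k
    unfolding P_def using lens_point_mem[OF vlV[OF that]] by simp
  have seg: "closed_segment (P j) (P k) \<subseteq> lens ?N" if "j < ?L" "k < ?L" for j k
    using that by (intro closed_segment_subset convex_lens P_lens)
  have straighten_P: "straighten ?N (P k) = position (?vl ! k)" if "k < ?L" for k
    unfolding P_def using straighten_lens_point[OF vlV[OF that]] by simp
  have P_inj: "P j \<noteq> P k" if "j < k" "k < ?L" for j k
  proof
    have jL: "j < ?L" using that by simp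
    assume "P j = P k"
    then have "position (?vl ! j) = position (?vl ! k)"
      using straighten_P[OF jL] straighten_P[OF that(2)] by simp
    then have "?vl ! j = ?vl ! k"
      using inj_onD[OF inj_on_position] vlV[OF jL] vlV[OF that(2)] by blast
    then show False using vl_inj[OF jL that(2)] that(1) by simp
  qed
  have edge_obtain: "\<exists>k. k < ?L \<and> root k < k \<and> e = edge k \<and>
      \<gamma> e = straighten ?N \<circ> linepath (P (root k)) (P k)" if "e \<in> E" for e
  proof -
    let ?k = "SOME k. k < ?L \<and> root k < k \<and> e = edge k"
    have "\<exists>k. k < ?L \<and> root k < k \<and> e = edge k" using that unfolding E_def by auto
    then have "?k < ?L \<and> root ?k < ?k \<and> e = edge ?k" by (rule someI_ex)
    moreover have "\<gamma> e = straighten ?N \<circ> linepath (P (root ?k)) (P ?k)"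
      by (simp only: \<gamma>_def Let_def)
    ultimately show ?thesis by (intro exI[of _ ?k] conjI) blast+
  qed
  have meet: "\<exists>k\<in>{root j, j} \<inter> {root i, i}. z = P k"
    if "j < ?L" "root j < j" "i < ?L" "root i < i" "i \<noteq> j"
      "z \<in> closed_segment (P (root j)) (P j)" "z \<in> closed_segment (P (root i)) (P i)" for i j z
  proof -
    \<comment> \<open>Interleaving edges would belong to one block and so start at the same root.\<close>
    have cross: "\<not> (root i < root j \<and> root j < i \<and> i < j)" if "i < ?L" "j < ?L" for i j
    proof
      assume *: "root i < root j \<and> root j < i \<and> i < j"
      then have "\<kappa> (?vl ! root i) = \<kappa> (?vl ! root j)"
        using noncrossingD[OF nc, of "root i" "root j" i j] that root_colour by simp
      then have "root i = root j" using root_colour root_eq by metis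
      with * show False by simp
    qed
    show ?thesis
      using that cross[of i j] cross[of j i] P_def
      by (intro chords_meet[of "root j" j m n "root i" i z P]) auto
  qed
  have drawn: "drawing m n E \<gamma>"
    unfolding drawing_def
  proof (intro conjI ballI impI)
    fix e assume "e \<in> E"
    then obtain k where k: "k < ?L" "root k < k" "e = edge k"
        "\<gamma> e = straighten ?N \<circ> linepath (P (root k)) (P k)"
      using edge_obtain by blast
    have r: "root k < ?L" using k by simp
    let ?S = "closed_segment (P (root k)) (P k)"
    have img: "path_image (\<gamma> e) = straighten ?N ` ?S" by (simp add: k(4) path_image_compose)
    show "arc (\<gamma> e)"
      unfolding k(4)
      unfolding arc_def
    proof
      show "path (straighten ?N \<circ> linepath (P (root k)) (P k))"
        using continuous_on_subset[OF continuous_on_straighten seg[OF r k(1)]]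
        by (intro path_continuous_image) simp_all
      have "inj_on (linepath (P (root k)) (P k)) {0..1}"
        using arc_linepath[OF P_inj[OF k(2,1)]] by (simp add: arc_def)
      moreover have "inj_on (straighten ?N) (linepath (P (root k)) (P k) ` {0..1})"
        using inj_on_subset[OF inj_on_straighten seg[OF r k(1)]]
        by (simp add: linepath_image_01)
      ultimately show "inj_on (straighten ?N \<circ> linepath (P (root k)) (P k)) {0..1}"
        by (rule comp_inj_on)
    qed
    show "{pathstart (\<gamma> e), pathfinish (\<gamma> e)} = position ` e"
      unfolding k(4) using straighten_P[OF r] straighten_P[OF k(1)]
      by (simp add: pathstart_compose pathfinish_compose k(3) edge_def)
    show "path_image (\<gamma> e) \<subseteq> cbox (vector [1, 0]) (vector [?N, 1])"
      unfolding img using seg[OF r k(1)] straighten_mem_cbox by blast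
    show "path_image (\<gamma> e) \<inter> position ` ?V = position ` e"
    proof (intro equalityI subsetI)
      fix z assume "z \<in> path_image (\<gamma> e) \<inter> position ` ?V"
      then obtain p v where p: "p \<in> ?S" "z = straighten ?N p" and v: "v \<in> ?V" "z = position v"
        unfolding img by blast
      then obtain l where l: "l < ?L" "v = ?vl ! l"
        unfolding set_vlist[symmetric] in_set_conv_nth by blast
      then have "straighten ?N p = straighten ?N (P l)" using straighten_P p v by simp
      then have pl: "p = P l"
        using inj_onD[OF inj_on_straighten] p(1) seg[OF r k(1)] P_lens[OF l(1)] by blast
      have "l \<in> {root k, k}"
      proof (rule ccontr)
        assume ne: "l \<notin> {root k, k}"
        then consider "l < root k" | "root k < l" by fastforce
        then have "\<exists>i\<in>{root k, k} \<inter> {l, k}. p = P i"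
        proof cases
          case 1
          then show ?thesis
            using k p pl P_def ne by (intro chords_meet[of "root k" k m n l k p P]) auto
        next
          case 2
          then have "\<exists>i\<in>{root k, k} \<inter> {root k, l}. p = P i"
            using k p pl P_def ne l by (intro chords_meet[of "root k" k m n "root k" l p P]) auto
          then have "p = P (root k)" using ne by auto
          then show ?thesis using P_inj[of "root k" l] 2 l pl by auto
        qed
        then have "p = P k" using ne by auto
        then show False using pl ne l(1) k(1) P_inj[of l k] P_inj[of k l] by (metis insertI1 insertI2 linorder_neqE_nat)
      qed
      then show "z \<in> position ` e" using l v k(3) by (auto simp: edge_def)
    next
      fix z assume "z \<in> position ` e"
      then show "z \<in> path_image (\<gamma> e) \<inter> position ` ?V"
        unfolding img unfolding k(3) edge_def using straighten_P[OF r] straighten_P[OF k(1)] vlV[OF r] vlV[OF k(1)]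
        by (auto intro: image_eqI[of _ _ "P (root k)"] image_eqI[of _ _ "P k"])
    qed
  next
    fix e f assume "e \<in> E" "f \<in> E" "e \<noteq> f"
    from edge_obtain[OF this(1)] obtain j where j: "j < ?L" "root j < j" "e = edge j"
        "\<gamma> e = straighten ?N \<circ> linepath (P (root j)) (P j)" by blast
    from edge_obtain[OF \<open>f \<in> E\<close>] obtain i where i: "i < ?L" "root i < i" "f = edge i"
        "\<gamma> f = straighten ?N \<circ> linepath (P (root i)) (P i)" by blast
    have ij: "i \<noteq> j" using \<open>e \<noteq> f\<close> i(3) j(3) by auto
    show "path_image (\<gamma> e) \<inter> path_image (\<gamma> f) \<subseteq> position ` (e \<inter> f)"
    proof
      fix z assume "z \<in> path_image (\<gamma> e) \<inter> path_image (\<gamma> f)"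
      then obtain p q where p: "p \<in> closed_segment (P (root j)) (P j)" "z = straighten ?N p"
          and q: "q \<in> closed_segment (P (root i)) (P i)" "z = straighten ?N q"
        unfolding i(4) j(4) path_image_compose path_image_linepath by blast
      have "p \<in> lens ?N" "q \<in> lens ?N"
        using p q seg[of "root j" j] seg[of "root i" i] i j by auto
      then have "p = q" using inj_onD[OF inj_on_straighten] p q by metis
      then obtain k where k: "k \<in> {root j, j} \<inter> {root i, i}" "p = P k"
        using meet[of j i p] i j ij p q by blast
      then have "z = position (?vl ! k)" using p(2) straighten_P[of k] i j by auto
      moreover have "?vl ! k \<in> e \<inter> f" using k i j by (auto simp: edge_def)
      ultimately show "z \<in> position ` (e \<inter> f)" by blast
    qed
  qed
  show ?thesis unfolding planar_def using graph comps drawn by blast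
qed

lemma planar_part_of: "planar m n (part_of m n \<kappa>) \<longleftrightarrow> noncrossing (map \<kappa> (vlist m n))"
  using planar_imp_noncrossing noncrossing_imp_planar by blast

section \<open>The product as composition of relations\<close>

lemma product_graph:
  fixes m n k :: nat and \<alpha> \<beta> :: part
  defines "V \<equiv> product_verts m n k"
    and "r \<equiv> {(u, v). u \<in> product_verts m n k \<and> v \<in> product_verts m n k \<and>
      (u, v) \<in> {(x, y). {x, y} \<in> product_edges \<alpha> \<beta>}\<^sup>*}"
  shows "equiv V r" "graph_components V (product_edges \<alpha> \<beta>) = V // r"
    "pcomp m n k \<alpha> \<beta> = (\<inter>) (verts m k) ` (V // r) - {{}}"
proof -
  have "sym {(x, y). {x, y} \<in> product_edges \<alpha> \<beta>}"
    by (auto simp: sym_def insert_commute)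
  then have "sym ({(x, y). {x, y} \<in> product_edges \<alpha> \<beta>}\<^sup>*)" by (rule sym_rtrancl)
  then show "equiv V r"
    unfolding V_def r_def by (intro equivI) (auto simp: refl_on_def sym_def trans_def)
  show "graph_components V (product_edges \<alpha> \<beta>) = V // r"
    by (simp add: graph_components_def V_def r_def)
  then show "pcomp m n k \<alpha> \<beta> = (\<inter>) (verts m k) ` (V // r) - {{}}"
    unfolding pcomp_def V_def by (auto simp: Int_commute)
qed

lemma verts_subset_product: "verts m k \<subseteq> product_verts m n k"
  by (auto simp: verts_def product_verts_def)

lemma pcomp_partition: "pcomp m n k \<alpha> \<beta> \<in> partitions m k"
  using partition_on_restrict[OF partition_on_quotient[OF product_graph(1)], of "verts m k" m n k \<alpha> \<beta>]
    verts_subset_product[of m k n]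
  by (simp add: partitions_def product_graph(3) Int_absorb2)

text \<open>A labeling of the outer vertices that is constant on the blocks of the product extends to one of
  the product graph that is constant on components, and such a labeling restricts to block-constant
  labelings of both factors.\<close>

lemma labelings_pcomp:
  assumes \<alpha>: "\<alpha> \<in> partitions m n" and \<beta>: "\<beta> \<in> partitions n k"
  shows "labelings m k (pcomp m n k \<alpha> \<beta>) = labelings m n \<alpha> O labelings n k \<beta>"
proof -
  let ?V = "product_verts m n k"
  let ?e = "{(x, y). {x, y} \<in> product_edges \<alpha> \<beta>}"
  let ?r = "{(u, v). u \<in> ?V \<and> v \<in> ?V \<and> (u, v) \<in> ?e\<^sup>*}"
  note eq = product_graph(1)[of m n k \<alpha> \<beta>]
  have edge1: "(rename_down u, rename_down v) \<in> ?e\<^sup>*" if "B \<in> \<alpha>" "u \<in> B" "v \<in> B" for u v B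
  proof (cases "u = v")
    case False
    then have "{u, v} \<in> part_edges \<alpha>" using that by (auto simp: part_edges_def)
    then have "rename_down ` {u, v} \<in> product_edges \<alpha> \<beta>" unfolding product_edges_def by blast
    then show ?thesis by auto
  qed simp
  have edge2: "(rename_up u, rename_up v) \<in> ?e\<^sup>*" if "B \<in> \<beta>" "u \<in> B" "v \<in> B" for u v B
  proof (cases "u = v")
    case False
    then have "{u, v} \<in> part_edges \<beta>" using that by (auto simp: part_edges_def)
    then have "rename_up ` {u, v} \<in> product_edges \<alpha> \<beta>" unfolding product_edges_def by blast
    then show ?thesis by auto
  qed simp
  have A: "u \<in> verts m n" if "B \<in> \<alpha>" "u \<in> B" for B u
    using \<alpha> that partition_onD1 unfolding partitions_def by blast
  have B: "u \<in> verts n k" if "B \<in> \<beta>" "u \<in> B" for B u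
    using \<beta> that partition_onD1 unfolding partitions_def by blast
  show ?thesis
  proof (intro equalityI subrelI)
    fix f h assume "(f, h) \<in> labelings m k (pcomp m n k \<alpha> \<beta>)"
    then have len: "length f = m" "length h = k"
      and "\<forall>B\<in>pcomp m n k \<alpha> \<beta>. \<forall>u\<in>B. \<forall>v\<in>B. lab f h u = lab f h v"
      unfolding labelings_def mem_Collect_eq case_prod_conv by blast+
    then have blocks: "lab f h u = lab f h v" if "B \<in> pcomp m n k \<alpha> \<beta>" "u \<in> B" "v \<in> B" for B u v
      using that by blast
    have const: "lab f h u = lab f h v"
      if "C \<in> ?V // ?r" "u \<in> C" "v \<in> C" "u \<in> verts m k" "v \<in> verts m k" for C u v
    proof (rule blocks)
      show "verts m k \<inter> C \<in> pcomp m n k \<alpha> \<beta>"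
        using that imageI[OF that(1), of "(\<inter>) (verts m k)"] by (auto simp: product_graph(3))
    qed (use that in auto)
    \<comment> \<open>Components without outer vertices are labelled \<open>False\<close>.\<close>
    define L where "L x \<longleftrightarrow> (\<exists>u\<in>verts m k. (x, u) \<in> ?r \<and> lab f h u)" for x
    have L_outer: "L u = lab f h u" if "u \<in> verts m k" for u
    proof -
      have uV: "u \<in> ?V" using that verts_subset_product by blast
      have "lab f h u' = lab f h u" if "(u, u') \<in> ?r" "u' \<in> verts m k" for u'
        using that \<open>u \<in> verts m k\<close> uV by (intro const[OF quotientI[OF uV]]) auto
      moreover have "(u, u) \<in> ?r" using uV by simp
      ultimately show ?thesis using that unfolding L_def by blast
    qed
    have L_const: "L x = L y" if "(x, y) \<in> ?r" for x y
      using that eq unfolding L_def by (meson equivE symD transD)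
    define g where "g = map (\<lambda>i. L (DPrimed i)) [1..<Suc n]"
    have g: "g ! (i - 1) = L (DPrimed i)" if "i \<in> {1..n}" for i
      using that by (auto simp: g_def nth_upt simp del: upt_Suc)
    have 1: "lab f g v = L (rename_down v) \<and> rename_down v \<in> ?V" if "v \<in> verts m n" for v
    proof (cases v)
      case (Unprimed i)
      then have "v \<in> verts m k" using that by (auto simp: verts_def)
      then show ?thesis using Unprimed L_outer[of v] verts_subset_product by auto
    qed (use that g in \<open>auto simp: verts_def product_verts_def\<close>)
    have 2: "lab g h v = L (rename_up v) \<and> rename_up v \<in> ?V" if "v \<in> verts n k" for v
    proof (cases v)
      case (Primed i)
      then have "v \<in> verts m k" using that by (auto simp: verts_def)
      then show ?thesis using Primed L_outer[of v] verts_subset_product by auto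
    qed (use that g in \<open>auto simp: verts_def product_verts_def\<close>)
    have "(f, g) \<in> labelings m n \<alpha>"
      unfolding labelings_def using len A 1 L_const edge1 by (auto simp: g_def)
    moreover have "(g, h) \<in> labelings n k \<beta>"
      unfolding labelings_def using len B 2 L_const edge2 by (auto simp: g_def)
    ultimately show "(f, h) \<in> labelings m n \<alpha> O labelings n k \<beta>" by blast
  next
    fix f h assume "(f, h) \<in> labelings m n \<alpha> O labelings n k \<beta>"
    then obtain g where fg: "(f, g) \<in> labelings m n \<alpha>" and gh: "(g, h) \<in> labelings n k \<beta>" by blast
    define L where "L v = (case v of Unprimed i \<Rightarrow> f ! (i - 1) | Primed i \<Rightarrow> h ! (i - 1)
      | DPrimed i \<Rightarrow> g ! (i - 1))" for v
    have L1: "L (rename_down v) = lab f g v" if "v \<in> verts m n" for v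
      using that by (cases v) (auto simp: L_def verts_def)
    have L2: "L (rename_up v) = lab g h v" if "v \<in> verts n k" for v
      using that by (cases v) (auto simp: L_def verts_def)
    have L3: "L v = lab f h v" if "v \<in> verts m k" for v
      using that by (cases v) (auto simp: L_def verts_def)
    have const: "L x = L y" if "(x, y) \<in> ?e\<^sup>*" for x y
      using that
    proof induction
      case (step y z)
      from step(2) have "{y, z} \<in> product_edges \<alpha> \<beta>" by simp
      then have "L y = L z"
        unfolding product_edges_def
      proof
        assume "{y, z} \<in> (`) rename_down ` part_edges \<alpha>"
        then obtain u v B where "{y, z} = rename_down ` {u, v}" "B \<in> \<alpha>" "u \<in> B" "v \<in> B"
          unfolding part_edges_def by blast
        moreover from this have "lab f g u = lab f g v"
          using fg unfolding labelings_def by blast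
        ultimately have "{y, z} = rename_down ` {u, v}" "L (rename_down u) = L (rename_down v)"
          using L1[OF A] by metis+
        then show ?thesis by (auto simp: doubleton_eq_iff)
      next
        assume "{y, z} \<in> (`) rename_up ` part_edges \<beta>"
        then obtain u v B where "{y, z} = rename_up ` {u, v}" "B \<in> \<beta>" "u \<in> B" "v \<in> B"
          unfolding part_edges_def by blast
        moreover from this have "lab g h u = lab g h v"
          using gh unfolding labelings_def by blast
        ultimately have "{y, z} = rename_up ` {u, v}" "L (rename_up u) = L (rename_up v)"
          using L2[OF B] by metis+
        then show ?thesis by (auto simp: doubleton_eq_iff)
      qed
      with step show ?case by simp
    qed simp
    have "lab f h u = lab f h v" if "C \<in> ?V // ?r" "u \<in> verts m k \<inter> C" "v \<in> verts m k \<inter> C" for C u v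
    proof -
      have "(u, v) \<in> ?r" using quotient_eq_iff[OF eq that(1) that(1)] that by blast
      then show ?thesis using const L3 that by auto
    qed
    then show "(f, h) \<in> labelings m k (pcomp m n k \<alpha> \<beta>)"
      using fg gh unfolding labelings_def product_graph(3) by blast
  qed
qed

section \<open>The planar and Temperley-Lieb categories\<close>

lemma labelings_PP: "labelings m n ` PP m n = planar_rels m n"
proof (intro equalityI subsetI)
  fix R assume "R \<in> labelings m n ` PP m n"
  then obtain \<alpha> where \<alpha>: "R = labelings m n \<alpha>" "\<alpha> \<in> partitions m n" "planar m n \<alpha>"
    by (auto simp: PP_def)
  obtain \<kappa> where "\<alpha> = part_of m n \<kappa>" using partition_colouring[OF \<alpha>(2)] .
  then show "R \<in> planar_rels m n"
    using \<alpha> by (auto simp: planar_part_of labelings_part_of map_vlist intro: planar_relsI)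
next
  fix R assume "R \<in> planar_rels m n"
  then obtain fs gs where R: "R = rel fs gs" "length fs = m" "length gs = n"
      "noncrossing (gs @ rev fs)" by (rule planar_relsE)
  then have "R = labelings m n (part_of m n (lab fs gs))" "part_of m n (lab fs gs) \<in> PP m n"
    by (auto simp: PP_def part_of_partition planar_part_of labelings_part_of map_vlist
        upper_lab lower_lab)
  then show "R \<in> labelings m n ` PP m n" by (rule image_eqI)
qed

lemma labelings_TL: "labelings m n ` TL m n = TL_rels m n"
proof (intro equalityI subsetI)
  fix R assume "R \<in> labelings m n ` TL m n"
  then obtain \<alpha> where \<alpha>: "R = labelings m n \<alpha>" "\<alpha> \<in> partitions m n" "planar m n \<alpha>" "\<forall>B\<in>\<alpha>. card B = 2"
    by (auto simp: PP_def TL_def)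
  obtain \<kappa> where "\<alpha> = part_of m n \<kappa>" using partition_colouring[OF \<alpha>(2)] .
  then show "R \<in> TL_rels m n"
    using \<alpha> card_blocks_part_of[of m n \<kappa>]
    by (auto simp: planar_part_of labelings_part_of map_vlist intro: TL_relsI)
next
  fix R assume "R \<in> TL_rels m n"
  then obtain fs gs where R: "R = rel fs gs" "length fs = m" "length gs = n"
      "noncrossing (gs @ rev fs)" "paired (gs @ rev fs)" by (rule TL_relsE)
  then have "R = labelings m n (part_of m n (lab fs gs))" "part_of m n (lab fs gs) \<in> TL m n"
    using card_blocks_part_of[of m n "lab fs gs"]
    by (auto simp: PP_def TL_def part_of_partition planar_part_of labelings_part_of map_vlist
        upper_lab lower_lab)
  then show "R \<in> labelings m n ` TL m n" by (rule image_eqI)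
qed

text \<open>A family \<open>K\<close> of hom-sets of partitions whose sets of labelings are the hom-sets of a category of
  relations generated by caps and cups. As \<open>labelings\<close> is faithful, properties of that category hold
  in \<open>K\<close>.\<close>

locale diagram_category = cap_chain H I s N c
  for H :: "nat \<Rightarrow> nat \<Rightarrow> bool list rel set" and I s N c +
  fixes K :: "nat \<Rightarrow> nat \<Rightarrow> part set"
  assumes K_partitions: "K m n \<subseteq> partitions m n"
    and labelings_K: "labelings m n ` K m n = H m n"
begin

lemma K_ex: "R \<in> H m n \<Longrightarrow> \<exists>\<alpha>\<in>K m n. labelings m n \<alpha> = R"
  by (auto simp flip: labelings_K)

lemma K_mem: "\<alpha> \<in> K m n \<Longrightarrow> labelings m n \<alpha> \<in> H m n"
  by (auto simp flip: labelings_K)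

lemma K_eq: "\<alpha> \<in> partitions m n \<Longrightarrow> \<beta> \<in> K m n \<Longrightarrow> labelings m n \<alpha> = labelings m n \<beta> \<Longrightarrow> \<alpha> = \<beta>"
  using labelings_inj[of \<alpha> m n \<beta>] K_partitions[of m n] by blast

lemma labelings_comp: "\<alpha> \<in> K m n \<Longrightarrow> \<beta> \<in> K n k \<Longrightarrow>
    labelings m k (pcomp m n k \<alpha> \<beta>) = labelings m n \<alpha> O labelings n k \<beta>"
  using labelings_pcomp[of \<alpha> m n \<beta> k] K_partitions[of m n] K_partitions[of n k] by blast

lemma K_closed: "\<alpha> \<in> K m n \<Longrightarrow> \<beta> \<in> K n k \<Longrightarrow> pcomp m n k \<alpha> \<beta> \<in> K m k"
proof -
  assume *: "\<alpha> \<in> K m n" "\<beta> \<in> K n k"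
  then obtain \<gamma> where "\<gamma> \<in> K m k" "labelings m k \<gamma> = labelings m n \<alpha> O labelings n k \<beta>"
    using K_ex[OF comp_mem[OF K_mem K_mem]] by blast
  then show ?thesis using K_eq[OF pcomp_partition, of \<gamma> m k n \<alpha> \<beta>] labelings_comp[OF *] by simp
qed

lemma K_assoc: "\<alpha> \<in> K m n \<Longrightarrow> \<beta> \<in> K n k \<Longrightarrow> \<gamma> \<in> K k l \<Longrightarrow>
    pcomp m k l (pcomp m n k \<alpha> \<beta>) \<gamma> = pcomp m n l \<alpha> (pcomp n k l \<beta> \<gamma>)"
  by (intro K_eq[OF pcomp_partition] K_closed) (simp_all add: labelings_comp K_closed O_assoc)

text \<open>The identity partition on \<open>m\<close>, described by its relation of labelings.\<close>

definition unit_diagram :: "nat \<Rightarrow> part" where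
  "unit_diagram m = (SOME \<iota>. \<iota> \<in> K m m \<and> labelings m m \<iota> = I m)"

lemma unit_diagram_mem: "unit_diagram m \<in> K m m" "labelings m m (unit_diagram m) = I m"
  using someI_ex[of "\<lambda>\<iota>. \<iota> \<in> K m m \<and> labelings m m \<iota> = I m"] K_ex[OF id_mem[of m]]
  unfolding unit_diagram_def by blast+

lemma K_idem_generated:
  assumes "\<alpha> \<in> K n n" shows "\<alpha> \<in> idem_generated (K n n) (pcomp n n n)"
proof -
  have "\<exists>\<beta>\<in>idem_generated (K n n) (pcomp n n n). \<beta> \<in> K n n \<and> labelings n n \<beta> = R"
    if "R \<in> idem_generated (H n n) (O)" for R
    using that
  proof induction
    case (idem R)
    then obtain \<beta> where \<beta>: "\<beta> \<in> K n n" "labelings n n \<beta> = R" and "R O R = R"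
      using K_ex[of R n n] by (auto simp: idempotents_def)
    then have "pcomp n n n \<beta> \<beta> = \<beta>"
      by (intro K_eq[OF pcomp_partition]) (simp_all add: labelings_comp)
    then have "\<beta> \<in> idem_generated (K n n) (pcomp n n n)"
      using \<beta> by (intro idem_generated.idem) (simp add: idempotents_def)
    then show ?case using \<beta> by blast
  next
    case (mult R S)
    then show ?case by (metis K_closed labelings_comp idem_generated.mult)
  qed
  from this[OF idempotent_generated[OF K_mem[OF assms]]]
  show ?thesis by (metis K_eq K_partitions assms subsetD)
qed

lemma K_split:
  assumes "\<alpha> \<in> K m n"
  shows "\<exists>r. \<exists>a\<in>K m r. \<exists>b\<in>K r n. \<exists>a'\<in>K r m. \<exists>b'\<in>K n r.
      pcomp r m r a' a = unit_diagram r \<and> pcomp r n r b b' = unit_diagram r \<and> \<alpha> = pcomp m r n a b"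
proof -
  obtain r R S where RS: "R \<in> H r m" "S \<in> H r n" "R O R\<inverse> = I r" "S O S\<inverse> = I r"
      "labelings m n \<alpha> = R\<inverse> O S"
    using split_factorisation[OF K_mem[OF assms]] by blast
  obtain a b a' b' where *: "a \<in> K m r" "labelings m r a = R\<inverse>" "b \<in> K r n" "labelings r n b = S"
      "a' \<in> K r m" "labelings r m a' = R" "b' \<in> K n r" "labelings n r b' = S\<inverse>"
    using RS(1,2) conv K_ex by metis
  then have "pcomp r m r a' a = unit_diagram r" "pcomp r n r b b' = unit_diagram r" "pcomp m r n a b = \<alpha>"
    using RS assms by (auto intro!: K_eq[OF pcomp_partition] simp: unit_diagram_mem labelings_comp)
  with * show ?thesis by blast
qed

theorem idem_generated_P_set_Reg:
  assumes "\<sigma> \<in> K n m"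
  shows "idem_generated (K m n) (sandwich m n \<sigma>) = P_set K m n \<sigma>"
    and "P_set K m n \<sigma> = Reg (K m n) (sandwich m n \<sigma>)"
proof -
  have "pcomp m m n (unit_diagram m) \<alpha> = \<alpha>" "pcomp m n n \<alpha> (unit_diagram n) = \<alpha>" if "\<alpha> \<in> K m n" for m n \<alpha>
    using that by (auto intro!: K_eq[OF pcomp_partition]
        simp: unit_diagram_mem labelings_comp id_left[OF K_mem] id_right[OF K_mem])
  note * = sandwich_regular_idempotent_generated[of K unit_diagram, OF K_closed K_assoc this K_split
      K_idem_generated assms]
  show "idem_generated (K m n) (sandwich m n \<sigma>) = P_set K m n \<sigma>" by (rule *(1))
  show "P_set K m n \<sigma> = Reg (K m n) (sandwich m n \<sigma>)" by (rule *(2))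
qed

end

interpretation PP_diagrams: diagram_category planar_rels id_rel 1 "\<lambda>m. 2 * m + 1" planar_cap PP
  by unfold_locales (auto simp: labelings_PP, simp add: PP_def)

interpretation TL_diagrams: diagram_category TL_rels id_rel 2 "\<lambda>m. m + 1" "\<lambda>m i. pair_rel i m" TL
  by unfold_locales (auto simp: labelings_TL, simp add: TL_def PP_def)

theorem theorem5p15:
  fixes K :: "nat \<Rightarrow> nat \<Rightarrow> part set" and m n :: nat and \<sigma> :: part
  assumes "K = TL \<or> K = PP"
    and "\<sigma> \<in> K n m"
  shows "idem_generated (K m n) (sandwich m n \<sigma>) = P_set K m n \<sigma> \<and>
         P_set K m n \<sigma> = Reg (K m n) (sandwich m n \<sigma>)"
  using assms PP_diagrams.idem_generated_P_set_Reg TL_diagrams.idem_generated_P_set_Reg by blast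

end
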